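(* Each normal timelike extremal $g(t)$, $t\in\mathbb{R}$, of the sub-Lorentzian (anti)metric $d$ on $\mathrm{GL}^+(2,\mathbb{C})$ with origin $g(0)=e$ is a product of two 1-parameter subgroups: $$g(t)=\exp\left(t\sum_{i=0}^6\alpha_ie_i\right)\exp\left(-t\sum_{i=4}^6\alpha_ie_i\right),$$ where $\alpha_i$, $i=0,\dots,6$, are some arbitrary real constants such that $$\alpha_0=\sqrt{1+\alpha_1^2+\alpha_2^2+\alpha_3^2}$$ (i.e. every such extremal has this form for some such constants, and every choice of real constants satisfying this relation occurs).
   Context: $\mathrm{GL}^+(2,\mathbb{C})$ is the Lie group of complex $2\times2$ matrices with positive real determinant, with unit $e=I$; its Lie algebra $\mathfrak{g}=\mathfrak{gl}^+(2,\mathbb{C})$ (complex $2\times2$ matrices with real trace) has the real basis $e_0=\frac12 I$, $e_1=\frac12\begin{pmatrix}0&1\\1&0\end{pmatrix}$, $e_2=\frac12\begin{pmatrix}0&\mathbf{i}\\-\mathbf{i}&0\end{pmatrix}$, $e_3=\frac12\begin{pmatrix}1&0\\0&-1\end{pmatrix}$, $e_4=\mathbf{i}e_1$, $e_5=\mathbf{i}e_2$, $e_6=\mathbf{i}e_3$. $H=\mathrm{span}_{\mathbb{R}}(e_0,e_1,e_2,e_3)$ is the space of Hermitian matrices, with pseudoscalar product $\langle\cdot,\cdot\rangle$ whose quadratic form is $\langle h,h\rangle=h_0^2-h_1^2-h_2^2-h_3^2=4\det h$. $l_g:h\mapsto gh$ is the left shift. A horizontal curve is a Lipschitzian curve with $g'(t)=dl_{g(t)}(u(t))$,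 $u(t)\in H$ for almost all $t$; it is timelike (nonspacelike) if $\langle u(t),u(t)\rangle>0$ ($\ge 0$) and future directed if $\langle u(t),e_0\rangle>0$ for almost all $t$. The sub-Lorentzian (anti)metric $d(x,y)$ is the supremum of lengths $\int\sqrt{\langle u,u\rangle}\,dt$ of future directed nonspacelike horizontal curves from $x$ to $y$ ($-\infty$ if there are none). Let $U=\{u\in H\mid\langle u,u\rangle\ge1,\ \langle u,e_0\rangle>0\}$. A timelike extremal is a future directed horizontal curve $g(t)$, $t\in\mathbb{R}$, parametrized by arclength ($\langle u(t),u(t)\rangle=1$ a.e.), with measurable control $u(t)\in U$, for which there is an absolutely continuous nowhere vanishing $\psi(t)\in\mathfrak{g}^*$ such that for almost all $t$: $g'(t)=dl_{g(t)}(u(t))$; $\frac{d}{dt}\psi(t)(w)=\psi(t)([u(t),w])$ for all $w\in\mathfrak{g}$; $\psi(t)(u(t))=\min_{u\in U}\psi(t)(u)=M_0$ with a constant $M_0\ge0$. It is normal if $M_0>0$ for some such $\psi$. *)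

theory Defs
  imports "HOL-Analysis.Analysis"
begin

type_synonym cmat2 = "complex^2^2"

definition GL_plus :: "cmat2 set" where
  "GL_plus = {A. det A \<in> \<real> \<and> Re (det A) > 0}"

definition gl_plus :: "cmat2 set" where
  "gl_plus = {A. trace A \<in> \<real>}"

definition lie_bracket :: "cmat2 \<Rightarrow> cmat2 \<Rightarrow> cmat2" where
  "lie_bracket A B = A ** B - B ** A"

text \<open>The multiplication of the type \<^typ>\<open>cmat2\<close> as an instance of the ring
  classes is entrywise, so neither \<^const>\<open>power\<close> nor \<^const>\<open>exp\<close> is available for
  the matrix product.\<close>

definition matrix_power :: "cmat2 \<Rightarrow> nat \<Rightarrow> cmat2" where
  "matrix_power A n = (((**) A) ^^ n) (mat 1)"

definition matrix_exp :: "cmat2 \<Rightarrow> cmat2" where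
  "matrix_exp A = (\<Sum>n. matrix_power A n /\<^sub>R fact n)"

text \<open>The real basis $e_0, \dots, e_6$; only the indices \<open>0..6\<close> are meaningful.
  The matrix \<open>mat \<i>\<close> is the scalar matrix with diagonal entries \<open>\<i>\<close>.\<close>

definition gl_basis :: "nat \<Rightarrow> cmat2" where
  "gl_basis i =
    (let e0 = (1/2) *\<^sub>R mat 1;
         e1 = (1/2) *\<^sub>R vector [vector [0, 1], vector [1, 0]];
         e2 = (1/2) *\<^sub>R vector [vector [0, \<i>], vector [- \<i>, 0]];
         e3 = (1/2) *\<^sub>R vector [vector [1, 0], vector [0, - 1]]
     in [e0, e1, e2, e3, mat \<i> ** e1, mat \<i> ** e2, mat \<i> ** e3] ! i)"

definition Herm :: "cmat2 set" where
  "Herm = span (gl_basis ` {0..3})"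

text \<open>Since the trace of $e_i e_j$ is $\frac12\delta_{ij}$ for $i,j\le 3$, this is the
  coordinate of an element of \<^const>\<open>Herm\<close> with respect to \<open>gl_basis i\<close>, \<open>i \<le> 3\<close>.\<close>

definition Herm_coord :: "nat \<Rightarrow> cmat2 \<Rightarrow> real" where
  "Herm_coord i h = 2 * Re (trace (h ** gl_basis i))"

definition pseudo_inner :: "cmat2 \<Rightarrow> cmat2 \<Rightarrow> real" where
  "pseudo_inner h k =
     Herm_coord 0 h * Herm_coord 0 k - (\<Sum>i=1..3. Herm_coord i h * Herm_coord i k)"

lemma gl_basis_simps:
  "gl_basis 0 = (1/2) *\<^sub>R mat 1"
  "gl_basis 1 = (1/2) *\<^sub>R vector [vector [0, 1], vector [1, 0]]"
  "gl_basis 2 = (1/2) *\<^sub>R vector [vector [0, \<i>], vector [- \<i>, 0]]"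
  "gl_basis 3 = (1/2) *\<^sub>R vector [vector [1, 0], vector [0, - 1]]"
  "gl_basis 4 = mat \<i> ** gl_basis 1"
  "gl_basis 5 = mat \<i> ** gl_basis 2"
  "gl_basis 6 = mat \<i> ** gl_basis 3"
  by (simp_all add: gl_basis_def Let_def)

lemma cmat2_eq_iff:
  "(A::cmat2) = B \<longleftrightarrow> A$1$1 = B$1$1 \<and> A$1$2 = B$1$2 \<and> A$2$1 = B$2$1 \<and> A$2$2 = B$2$2"
  by (auto simp: vec_eq_iff forall_2)

lemma gl_basis_nth0:
  "gl_basis 0 $1$1 = 1/2" "gl_basis 0 $1$2 = 0" "gl_basis 0 $2$1 = 0" "gl_basis 0 $2$2 = 1/2"
  "gl_basis 1 $1$1 = 0" "gl_basis 1 $1$2 = 1/2" "gl_basis 1 $2$1 = 1/2" "gl_basis 1 $2$2 = 0"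
  "gl_basis 2 $1$1 = 0" "gl_basis 2 $1$2 = \<i>/2" "gl_basis 2 $2$1 = -\<i>/2" "gl_basis 2 $2$2 = 0"
  "gl_basis 3 $1$1 = 1/2" "gl_basis 3 $1$2 = 0" "gl_basis 3 $2$1 = 0" "gl_basis 3 $2$2 = -1/2"
  "gl_basis 4 $1$1 = 0" "gl_basis 4 $1$2 = \<i>/2" "gl_basis 4 $2$1 = \<i>/2" "gl_basis 4 $2$2 = 0"
  "gl_basis 5 $1$1 = 0" "gl_basis 5 $1$2 = -1/2" "gl_basis 5 $2$1 = 1/2" "gl_basis 5 $2$2 = 0"
  "gl_basis 6 $1$1 = \<i>/2" "gl_basis 6 $1$2 = 0" "gl_basis 6 $2$1 = 0" "gl_basis 6 $2$2 = -\<i>/2"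
  unfolding gl_basis_simps
  by (simp_all add: mat_def matrix_matrix_mult_def sum_2 complex_eq_iff)

lemmas gl_basis_nth = gl_basis_nth0 gl_basis_nth0(5-8)[unfolded One_nat_def]

lemma sum_0_3: "(\<Sum>i=0..3. f i) = f 0 + f 1 + f 2 + f (3::nat)"
  for f :: "nat \<Rightarrow> 'a::comm_monoid_add"
  by (simp add: numeral_eq_Suc)

lemma sum_0_6: "(\<Sum>i=0..6. f i) = f 0 + f 1 + f 2 + f 3 + f 4 + f 5 + f (6::nat)"
  for f :: "nat \<Rightarrow> 'a::comm_monoid_add"
  by (simp add: numeral_eq_Suc)

lemma sum_1_3: "(\<Sum>i=1..3. f i) = f 1 + f 2 + f (3::nat)"
  for f :: "nat \<Rightarrow> 'a::comm_monoid_add"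
  by (simp add: numeral_eq_Suc)

lemma in_span_image_sum:
  fixes b :: "nat \<Rightarrow> 'a::real_vector"
  shows "(\<Sum>i=m..n. a i *\<^sub>R b i) \<in> span (b ` {m..n})"
  by (intro span_sum span_mul span_base) auto

lemma Herm_eq: "Herm = {A. Im (A$1$1) = 0 \<and> Im (A$2$2) = 0 \<and> A$2$1 = cnj (A$1$2)}"
    (is "_ = ?S")
proof
  have "subspace ?S"
    by (auto simp: subspace_def)
  moreover have "gl_basis ` {0..3} \<subseteq> ?S"
  proof -
    have "{0..3} = {0,1,2,3::nat}" by auto
    then show ?thesis by (simp add: gl_basis_nth)
  qed
  ultimately show "Herm \<subseteq> ?S"
    unfolding Herm_def by (rule span_minimal[rotated])
next
  show "?S \<subseteq> Herm"
  proof
    fix A assume A: "A \<in> ?S"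
    define a where "a = (\<lambda>i::nat. [Re (A$1$1 + A$2$2), 2 * Re (A$1$2), 2 * Im (A$1$2),
      Re (A$1$1 - A$2$2)] ! i)"
    have "A = (\<Sum>i=0..3. a i *\<^sub>R gl_basis i)"
      using A unfolding sum_0_3 cmat2_eq_iff
      by (simp add: gl_basis_nth a_def complex_eq_iff algebra_simps flip: One_nat_def)
    then show "A \<in> Herm"
      unfolding Herm_def using in_span_image_sum by metis
  qed
qed

lemma gl_plus_eq: "gl_plus = span (gl_basis ` {0..6})"
proof
  have "subspace gl_plus"
    by (auto simp: subspace_def gl_plus_def trace_def sum_2 complex_is_Real_iff algebra_simps
        simp flip: distrib_left)
  moreover have "gl_basis ` {0..6} \<subseteq> gl_plus"
  proof -
    have "{0..6} = {0,1,2,3,4,5,6::nat}" by auto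
    then show ?thesis
      by (simp add: gl_basis_nth gl_plus_def trace_def sum_2 complex_is_Real_iff)
  qed
  ultimately show "span (gl_basis ` {0..6}) \<subseteq> gl_plus"
    by (rule span_minimal[rotated])
next
  show "gl_plus \<subseteq> span (gl_basis ` {0..6})"
  proof
    fix A assume "A \<in> gl_plus"
    then have A: "Im (A$2$2) = - Im (A$1$1)"
      by (simp add: gl_plus_def trace_def sum_2 complex_is_Real_iff)
    define a where "a = (\<lambda>i::nat. [Re (A$1$1 + A$2$2),
      Re (A$1$2 + A$2$1), Im (A$1$2 - A$2$1), Re (A$1$1 - A$2$2),
      Im (A$1$2 + A$2$1), Re (A$2$1 - A$1$2), Im (A$1$1 - A$2$2)] ! i)"
    have "A = (\<Sum>i=0..6. a i *\<^sub>R gl_basis i)"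
      using A unfolding sum_0_6 cmat2_eq_iff
      by (simp add: gl_basis_nth a_def complex_eq_iff field_simps flip: One_nat_def)
    then show "A \<in> span (gl_basis ` {0..6})"
      using in_span_image_sum by metis
  qed
qed

lemma Herm_coord_sum:
  assumes "j \<le> 3"
  shows "Herm_coord j (\<Sum>i=0..3. a i *\<^sub>R gl_basis i) = a j"
proof -
  have "j = 0 \<or> j = 1 \<or> j = 2 \<or> j = 3" using assms by auto
  then show ?thesis
    unfolding sum_0_3 Herm_coord_def
    by (elim disjE; simp add: trace_def matrix_matrix_mult_def sum_2 gl_basis_nth algebra_simps
        flip: One_nat_def; simp add: field_simps)
qed

lemma pseudo_inner_self:
  assumes "h \<in> Herm"
  shows "complex_of_real (pseudo_inner h h) = 4 * det h"
  using assms
  unfolding Herm_eq pseudo_inner_def sum_1_3 Herm_coord_def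
  by (simp add: trace_def matrix_matrix_mult_def sum_2 gl_basis_nth det_2 complex_eq_iff
      algebra_simps power2_eq_square)

text \<open>Vectors of the dual space are represented by functions on all matrices of which
  only the restriction to \<^const>\<open>gl_plus\<close> matters.\<close>

definition gl_plus_dual :: "(cmat2 \<Rightarrow> real) set" where
  "gl_plus_dual = {\<phi>. (\<forall>v\<in>gl_plus. \<forall>w\<in>gl_plus. \<phi> (v + w) = \<phi> v + \<phi> w) \<and>
                      (\<forall>c. \<forall>v\<in>gl_plus. \<phi> (c *\<^sub>R v) = c * \<phi> v)}"

definition absolutely_continuous_on :: "real set \<Rightarrow> (real \<Rightarrow> real) \<Rightarrow> bool" where
  "absolutely_continuous_on S f \<longleftrightarrow>
    (\<forall>\<epsilon>>0. \<exists>\<delta>>0. \<forall>(n::nat) a b.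
       (\<forall>i<n. a i \<le> b i \<and> {a i..b i} \<subseteq> S) \<and>
       disjoint_family_on (\<lambda>i. {a i<..<b i}) {..<n} \<and>
       (\<Sum>i<n. b i - a i) < \<delta>
       \<longrightarrow> (\<Sum>i<n. \<bar>f (b i) - f (a i)\<bar>) < \<epsilon>)"

text \<open>The Lipschitz condition on compact intervals does not depend on the Riemannian metric
  on the group, so the Euclidean one is used. The differential of the left shift by \<open>g\<close> is
  left multiplication by \<open>g\<close>.\<close>

definition horizontal_curve :: "(real \<Rightarrow> cmat2) \<Rightarrow> (real \<Rightarrow> cmat2) \<Rightarrow> bool" where
  "horizontal_curve g u \<longleftrightarrow>
     range g \<subseteq> GL_plus \<and>
     (\<forall>a b. \<exists>L. L-lipschitz_on {a..b} g) \<and>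
     (AE t in lebesgue. u t \<in> Herm \<and> (g has_vector_derivative g t ** u t) (at t))"

definition future_directed :: "(real \<Rightarrow> cmat2) \<Rightarrow> bool" where
  "future_directed u \<longleftrightarrow> (AE t in lebesgue. pseudo_inner (u t) (gl_basis 0) > 0)"

definition arclength_parametrized :: "(real \<Rightarrow> cmat2) \<Rightarrow> bool" where
  "arclength_parametrized u \<longleftrightarrow> (AE t in lebesgue. pseudo_inner (u t) (u t) = 1)"

definition control_set :: "cmat2 set" where
  "control_set = {u \<in> Herm. pseudo_inner u u \<ge> 1 \<and> pseudo_inner u (gl_basis 0) > 0}"

definition extremal_lift ::
    "(real \<Rightarrow> cmat2) \<Rightarrow> (real \<Rightarrow> cmat2) \<Rightarrow> (real \<Rightarrow> cmat2 \<Rightarrow> real) \<Rightarrow> real \<Rightarrow> bool" where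
  "extremal_lift g u \<psi> M0 \<longleftrightarrow>
     horizontal_curve g u \<and> future_directed u \<and> arclength_parametrized u \<and>
     u \<in> borel_measurable lebesgue \<and> range u \<subseteq> control_set \<and>
     range \<psi> \<subseteq> gl_plus_dual \<and>
     (\<forall>t. \<exists>w\<in>gl_plus. \<psi> t w \<noteq> 0) \<and>
     (\<forall>w\<in>gl_plus. \<forall>a b. absolutely_continuous_on {a..b} (\<lambda>t. \<psi> t w)) \<and>
     (AE t in lebesgue. \<forall>w\<in>gl_plus.
        ((\<lambda>s. \<psi> s w) has_real_derivative \<psi> t (lie_bracket (u t) w)) (at t)) \<and>
     M0 \<ge> 0 \<and>
     (AE t in lebesgue. is_arg_min (\<psi> t) (\<lambda>v. v \<in> control_set) (u t) \<and> \<psi> t (u t) = M0)"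

definition timelike_extremal :: "(real \<Rightarrow> cmat2) \<Rightarrow> bool" where
  "timelike_extremal g \<longleftrightarrow> (\<exists>u \<psi> M0. extremal_lift g u \<psi> M0)"

definition normal_extremal :: "(real \<Rightarrow> cmat2) \<Rightarrow> bool" where
  "normal_extremal g \<longleftrightarrow> (\<exists>u \<psi> M0. extremal_lift g u \<psi> M0 \<and> M0 > 0)"

end

theory Submission
  imports Defs
begin

text \<open>An extremal is determined by its covector, because the covector at time \<open>t\<close> attains its
  minimum over the control set at the control \<open>u t\<close>, a unit vector. If this minimum \<open>M\<close> is
  positive, the covector restricted to Hermitian matrices is \<open>M\<close> times the Lorentz product
  with \<open>u t\<close> (\<open>minimizer_imp_multiple_of_pseudo_inner\<close>). So \<open>u t\<close> can be read off from the
  covector, and it agrees almost everywhere with a continuous curve. An absolutely continuous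
  curve whose derivative is almost everywhere given by a continuous function is continuously
  differentiable (\<open>vector_absolutely_continuous_on_AE_derivative_continuous\<close>), and therefore
  the differential equations for the covector and for \<open>g\<close> hold at every time.

  For skew-Hermitian \<open>w\<close>, the bracket \<open>[u, w]\<close> is Hermitian and orthogonal to \<open>u\<close> for the
  Lorentz product. Hence the adjoint equation conserves the skew-Hermitian part of the
  covector. Identify this part, divided by \<open>M\<close>, with a constant skew-Hermitian matrix \<open>B\<close> of
  trace zero. The rest of the adjoint equation becomes \<open>u' = [B, u]\<close>
  (\<open>dual_lie_bracket_Herm_of\<close>), so \<open>u t = exp (t B) (u 0) exp (- t B)\<close>
  (\<open>lie_bracket_ode_unique\<close>). Then \<open>g t exp (t B)\<close> has the constant left-invariant velocity
  \<open>u 0 + B\<close>, which gives \<open>g t = exp (t (u 0 + B)) exp (- t B)\<close>. The relation between the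
  constants says that \<open>u 0\<close> is a unit future directed vector.

  Conversely, for given constants, conjugating the Hermitian part by \<open>exp (t B)\<close> defines a
  control that stays Hermitian and keeps its trace and determinant, hence its Lorentz norm.
  The Lorentz product with the control on Hermitian matrices, together with a multiple of the
  trace form with \<open>B\<close> on the skew-Hermitian ones, solves the adjoint equation, and by the
  reverse Cauchy-Schwarz inequality (\<open>pseudo_inner_ge_1\<close>) it has minimum 1 on the control set,
  attained at the control.\<close>

section \<open>Absolutely continuous curves with an almost everywhere continuous derivative\<close>

text \<open>The same condition as \<^const>\<open>absolutely_continuous_on\<close>, for values in a normed space: it
  covers the components of the covector and the matrix curve at once.\<close>

definition vector_absolutely_continuous_on :: "real set \<Rightarrow> (real \<Rightarrow> 'a::real_normed_vector) \<Rightarrow> bool" where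
  "vector_absolutely_continuous_on S f \<longleftrightarrow>
    (\<forall>\<epsilon>>0. \<exists>\<delta>>0. \<forall>(n::nat) a b.
       (\<forall>i<n. a i \<le> b i \<and> {a i..b i} \<subseteq> S) \<and>
       disjoint_family_on (\<lambda>i. {a i<..<b i}) {..<n} \<and>
       (\<Sum>i<n. b i - a i) < \<delta>
       \<longrightarrow> (\<Sum>i<n. norm (f (b i) - f (a i))) < \<epsilon>)"

lemma vector_absolutely_continuous_on_real:
  "vector_absolutely_continuous_on S f \<longleftrightarrow> absolutely_continuous_on S f"
  by (simp add: vector_absolutely_continuous_on_def absolutely_continuous_on_def)

lemma vector_absolutely_continuous_onE:
  assumes "vector_absolutely_continuous_on S f" "\<epsilon> > 0"
  obtains \<delta> where "\<delta> > 0"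
    "\<And>(n::nat) a b. \<lbrakk>\<And>i. i < n \<Longrightarrow> a i \<le> b i \<and> {a i..b i} \<subseteq> S;
       disjoint_family_on (\<lambda>i. {a i<..<b i}) {..<n}; (\<Sum>i<n. b i - a i) < \<delta>\<rbrakk>
       \<Longrightarrow> (\<Sum>i<n. norm (f (b i) - f (a i))) < \<epsilon>"
  using assms unfolding vector_absolutely_continuous_on_def by meson

lemma vector_absolutely_continuous_on_lipschitz:
  assumes "L-lipschitz_on S f"
  shows "vector_absolutely_continuous_on S f"
  unfolding vector_absolutely_continuous_on_def
proof (intro allI impI)
  fix \<epsilon> :: real assume "\<epsilon> > 0"
  have L: "L \<ge> 0" using assms by (rule lipschitz_on_nonneg)
  show "\<exists>\<delta>>0. \<forall>(n::nat) a b.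
       (\<forall>i<n. a i \<le> b i \<and> {a i..b i} \<subseteq> S) \<and>
       disjoint_family_on (\<lambda>i. {a i<..<b i}) {..<n} \<and>
       (\<Sum>i<n. b i - a i) < \<delta>
       \<longrightarrow> (\<Sum>i<n. norm (f (b i) - f (a i))) < \<epsilon>"
  \<comment> \<open>The summand 1 covers the case of a zero Lipschitz constant.\<close>
  proof (intro exI[of _ "\<epsilon> / (L + 1)"] conjI allI impI, goal_cases)
    case 1 then show ?case using \<open>\<epsilon> > 0\<close> L by simp
  next
    case (2 n a b)
    have "norm (f (b i) - f (a i)) \<le> L * (b i - a i)" if "i < n" for i
    proof -
      have "a i \<le> b i" "{a i..b i} \<subseteq> S" using 2 that by auto
      then have "a i \<in> S" "b i \<in> S" by auto
      then show ?thesis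
        using lipschitz_onD[OF assms, of "b i" "a i"] \<open>a i \<le> b i\<close> by (simp add: dist_norm)
    qed
    then have "(\<Sum>i<n. norm (f (b i) - f (a i))) \<le> (\<Sum>i<n. L * (b i - a i))"
      by (intro sum_mono) auto
    also have "\<dots> = L * (\<Sum>i<n. b i - a i)"
      by (simp add: sum_distrib_left)
    also have "\<dots> \<le> (L + 1) * (\<Sum>i<n. b i - a i)"
      using 2 by (intro mult_right_mono sum_nonneg) auto
    also have "\<dots> < \<epsilon>"
      using 2 L by (simp only: mult.commute pos_less_divide_eq)
    finally show ?case .
  qed
qed

lemma vector_absolutely_continuous_on_diff:
  assumes f: "vector_absolutely_continuous_on S f" and g: "vector_absolutely_continuous_on S g"
  shows "vector_absolutely_continuous_on S (\<lambda>t. f t - g t)"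
  unfolding vector_absolutely_continuous_on_def
proof (intro allI impI)
  fix \<epsilon> :: real assume "\<epsilon> > 0"
  then have e2: "\<epsilon> / 2 > 0" by simp
  obtain d1 where d1: "d1 > 0" "\<And>(n::nat) a b. \<lbrakk>\<And>i. i < n \<Longrightarrow> a i \<le> b i \<and> {a i..b i} \<subseteq> S;
       disjoint_family_on (\<lambda>i. {a i<..<b i}) {..<n}; (\<Sum>i<n. b i - a i) < d1\<rbrakk>
       \<Longrightarrow> (\<Sum>i<n. norm (f (b i) - f (a i))) < \<epsilon> / 2"
    using vector_absolutely_continuous_onE[OF f e2] by blast
  obtain d2 where d2: "d2 > 0" "\<And>(n::nat) a b. \<lbrakk>\<And>i. i < n \<Longrightarrow> a i \<le> b i \<and> {a i..b i} \<subseteq> S;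
       disjoint_family_on (\<lambda>i. {a i<..<b i}) {..<n}; (\<Sum>i<n. b i - a i) < d2\<rbrakk>
       \<Longrightarrow> (\<Sum>i<n. norm (g (b i) - g (a i))) < \<epsilon> / 2"
    using vector_absolutely_continuous_onE[OF g e2] by blast
  show "\<exists>\<delta>>0. \<forall>(n::nat) a b.
       (\<forall>i<n. a i \<le> b i \<and> {a i..b i} \<subseteq> S) \<and>
       disjoint_family_on (\<lambda>i. {a i<..<b i}) {..<n} \<and>
       (\<Sum>i<n. b i - a i) < \<delta>
       \<longrightarrow> (\<Sum>i<n. norm (f (b i) - g (b i) - (f (a i) - g (a i)))) < \<epsilon>"
  proof (intro exI[of _ "min d1 d2"] conjI allI impI, goal_cases)
    case 1 then show ?case using d1 d2 by simp
  next
    case (2 n a b)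
    have "(\<Sum>i<n. norm (f (b i) - g (b i) - (f (a i) - g (a i))))
        \<le> (\<Sum>i<n. norm (f (b i) - f (a i)) + norm (g (b i) - g (a i)))"
    proof (intro sum_mono)
      fix i
      have "f (b i) - g (b i) - (f (a i) - g (a i)) = (f (b i) - f (a i)) - (g (b i) - g (a i))"
        by simp
      then show "norm (f (b i) - g (b i) - (f (a i) - g (a i)))
          \<le> norm (f (b i) - f (a i)) + norm (g (b i) - g (a i))"
        by (simp only: norm_triangle_ineq4)
    qed
    also have "\<dots> < \<epsilon> / 2 + \<epsilon> / 2"
      unfolding sum.distrib
      by (rule add_strict_mono; rule d1(2)[of n a b] d2(2)[of n a b]) (use 2 in auto)
    finally show ?case by simp
  qed
qed

lemma vector_absolutely_continuous_on_subset:
  assumes "vector_absolutely_continuous_on S f" "T \<subseteq> S"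
  shows "vector_absolutely_continuous_on T f"
  using assms unfolding vector_absolutely_continuous_on_def by (meson subset_trans)

lemma vector_absolutely_continuous_on_imp_continuous_on:
  assumes "vector_absolutely_continuous_on {a..b} f"
  shows "continuous_on {a..b} f"
  unfolding continuous_on_iff
proof (intro ballI allI impI)
  fix x e assume x: "x \<in> {a..b}" and "(e::real) > 0"
  then obtain \<delta> where \<delta>: "\<delta> > 0" "\<And>(n::nat) c d. \<lbrakk>\<And>i. i < n \<Longrightarrow> c i \<le> d i \<and> {c i..d i} \<subseteq> {a..b};
       disjoint_family_on (\<lambda>i. {c i<..<d i}) {..<n}; (\<Sum>i<n. d i - c i) < \<delta>\<rbrakk>
       \<Longrightarrow> (\<Sum>i<n. norm (f (d i) - f (c i))) < e"
    using vector_absolutely_continuous_onE[OF assms \<open>e > 0\<close>] by blast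
  have step: "norm (f d - f c) < e" if "c \<le> d" "c \<in> {a..b}" "d \<in> {a..b}" "d - c < \<delta>" for c d
    using \<delta>(2)[of 1 "\<lambda>_. c" "\<lambda>_. d"] that by (simp add: disjoint_family_on_def)
  show "\<exists>\<delta>>0. \<forall>y\<in>{a..b}. dist y x < \<delta> \<longrightarrow> dist (f y) (f x) < e"
  proof (intro exI[of _ \<delta>] conjI ballI impI)
    fix y assume "y \<in> {a..b}" "dist y x < \<delta>"
    then show "dist (f y) (f x) < e"
      using step[of x y] step[of y x] x
      by (cases "x \<le> y") (auto simp: dist_norm norm_minus_commute)
  qed (rule \<delta>(1))
qed

text \<open>The Henstock argument. The exceptional null set \<open>N\<close> lies in an open set \<open>G\<close> of small measure.
  In a fine division, the intervals tagged in \<open>N\<close> lie in \<open>G\<close>, so absolute continuity makes the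
  variation of \<open>f\<close> on them small; on every other interval the variation is at most \<open>\<epsilon>\<close> times
  the length, because the derivative at the tag is zero.\<close>

lemma vector_absolutely_continuous_on_deriv_zero:
  fixes f :: "real \<Rightarrow> 'a::real_normed_vector"
  assumes "a \<le> b"
    and ac: "vector_absolutely_continuous_on {a..b} f"
    and ae: "AE t in lebesgue. t \<in> {a..b} \<longrightarrow> (f has_vector_derivative 0) (at t within {a..b})"
  shows "f b = f a"
proof -
  define N where "N = {t \<in> {a..b}. \<not> (f has_vector_derivative 0) (at t within {a..b})}"
  have "negligible N"
    using ae unfolding eventually_ae_filter_negligible N_def by (auto elim: negligible_subset)
  then have Nnull: "N \<in> sets lebesgue" "emeasure lebesgue N = 0"
    by (auto simp: negligible_iff_null_sets null_sets_def)
  have bound: "norm (f b - f a) \<le> \<epsilon> * (b - a + 1)" if "\<epsilon> > 0" for \<epsilon>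
  proof -
    obtain \<delta> where \<delta>: "\<delta> > 0" "\<And>(n::nat) c d. \<lbrakk>\<And>i. i < n \<Longrightarrow> c i \<le> d i \<and> {c i..d i} \<subseteq> {a..b};
       disjoint_family_on (\<lambda>i. {c i<..<d i}) {..<n}; (\<Sum>i<n. d i - c i) < \<delta>\<rbrakk>
       \<Longrightarrow> (\<Sum>i<n. norm (f (d i) - f (c i))) < \<epsilon>"
      using vector_absolutely_continuous_onE[OF ac \<open>\<epsilon> > 0\<close>] by blast
    obtain G where G: "open G" "N \<subseteq> G" "(G - N) \<in> lmeasurable"
      "emeasure lebesgue (G - N) < ennreal \<delta>"
      using sets_lebesgue_outer_open[OF Nnull(1) \<delta>(1)] by blast
    have emG: "emeasure lebesgue G < ennreal \<delta>"
    proof -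
      have "emeasure lebesgue G = emeasure lebesgue ((G - N) \<union> N)"
        using G(2) by (simp add: Un_absorb2)
      also have "\<dots> \<le> emeasure lebesgue (G - N) + emeasure lebesgue N"
        using G(3) Nnull(1) by (intro emeasure_subadditive) (auto simp: fmeasurable_def)
      finally show ?thesis using G(4) Nnull(2) by simp
    qed
    \<comment> \<open>Around the points of \<open>N\<close> the gauge confines the division to \<open>G\<close>; around the
      others it makes the difference quotients small.\<close>
    have "\<exists>r>0. if x \<in> N then ball x r \<subseteq> G
        else x \<in> {a..b} \<longrightarrow> (\<forall>y\<in>{a..b}. \<bar>y - x\<bar> < r \<longrightarrow> norm (f y - f x) \<le> \<epsilon> * \<bar>y - x\<bar>)" for x
    proof (cases "x \<in> N")
      case True
      then show ?thesis using G(1,2) by (auto simp: open_contains_ball)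
    next
      case False
      show ?thesis
      proof (cases "x \<in> {a..b}")
        case True
        then have "(f has_derivative (\<lambda>h. 0)) (at x within {a..b})"
          using False by (simp add: N_def has_vector_derivative_def)
        then show ?thesis
          using False True \<open>\<epsilon> > 0\<close> unfolding has_derivative_within_alt by simp
      qed (use False in \<open>auto intro: exI[of _ 1]\<close>)
    qed
    then obtain r where r0: "\<And>x. r x > 0 \<and> (if x \<in> N then ball x (r x) \<subseteq> G
        else x \<in> {a..b} \<longrightarrow> (\<forall>y\<in>{a..b}. \<bar>y - x\<bar> < r x \<longrightarrow> norm (f y - f x) \<le> \<epsilon> * \<bar>y - x\<bar>))"
      by metis
    have r: "\<And>x. r x > 0" "\<And>x. x \<in> N \<Longrightarrow> ball x (r x) \<subseteq> G"
      "\<And>x y. \<lbrakk>x \<notin> N; x \<in> {a..b}; y \<in> {a..b}; \<bar>y - x\<bar> < r x\<rbrakk> \<Longrightarrow> norm (f y - f x) \<le> \<epsilon> * \<bar>y - x\<bar>"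
      using r0 by presburger+
    have "gauge (\<lambda>x. ball x (r x))"
      using r(1) by (auto simp: gauge_def)
    then obtain p where p: "p tagged_division_of {a..b}" "(\<lambda>x. ball x (r x)) fine p"
      by (rule fine_division_exists_real)
    have fin: "finite p" using p(1) by auto
    have piece: "K = {Inf K..Sup K} \<and> Inf K \<le> x \<and> x \<le> Sup K \<and> {Inf K..Sup K} \<subseteq> {a..b}
        \<and> {Inf K..Sup K} \<subseteq> ball x (r x)" if xK: "(x, K) \<in> p" for x K
    proof -
      obtain u v where uv: "K = cbox u v" using tagged_division_ofD(4)[OF p(1) xK] by blast
      have "x \<in> K" "K \<subseteq> {a..b}" using tagged_division_ofD(2,3)[OF p(1) xK] by auto
      moreover have "K \<subseteq> ball x (r x)" using fineD[OF p(2) xK] .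
      moreover have "u \<le> v" using uv \<open>x \<in> K\<close> by auto
      ultimately show ?thesis using uv by auto
    qed
    have ends: "x \<in> {a..b} \<and> Inf K \<in> {a..b} \<and> Sup K \<in> {a..b} \<and> \<bar>Inf K - x\<bar> < r x \<and> \<bar>Sup K - x\<bar> < r x"
      if "(x, K) \<in> p" for x K
    proof -
      have "Inf K \<in> {Inf K..Sup K}" "Sup K \<in> {Inf K..Sup K}" "x \<in> {Inf K..Sup K}"
        using piece[OF that] by auto
      then have "Inf K \<in> ball x (r x)" "Sup K \<in> ball x (r x)"
        "x \<in> {a..b}" "Inf K \<in> {a..b}" "Sup K \<in> {a..b}"
        using piece[OF that] by blast+
      then show ?thesis by (auto simp: dist_real_def abs_minus_commute)
    qed
    let ?d = "\<lambda>(x::real, K). norm (f (Sup K) - f (Inf K))"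
    define q where "q = {z \<in> p. fst z \<in> N}"
    have finq: "finite q" and qp: "q \<subseteq> p" using fin by (auto simp: q_def)
    have "sum ?d q < \<epsilon>"
    proof -
      obtain h where h: "bij_betw h {0..<card q} q"
        using ex_bij_betw_nat_finite[OF finq] by blast
      define n where "n = card q"
      have h: "bij_betw h {..<n} q" using h by (simp add: n_def atLeast0LessThan)
      define c where "c i = Inf (snd (h i))" for i
      define d where "d i = Sup (snd (h i))" for i
      have hi: "(fst (h i), snd (h i)) \<in> p" "fst (h i) \<in> N" if "i < n" for i
        using bij_betwE[OF h] that by (auto simp: q_def)
      have sub: "c i \<le> d i \<and> {c i..d i} \<subseteq> {a..b}" if "i < n" for i
      proof
        show "c i \<le> d i" using piece[OF hi(1)[OF that]] unfolding c_def d_def by linarith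
        show "{c i..d i} \<subseteq> {a..b}" using piece[OF hi(1)[OF that]] unfolding c_def d_def by blast
      qed
      have inG: "{c i<..<d i} \<subseteq> G" if "i < n" for i
      proof -
        have "{c i<..<d i} \<subseteq> {c i..d i}" by auto
        also have "\<dots> \<subseteq> ball (fst (h i)) (r (fst (h i)))"
          using piece[OF hi(1)[OF that]] unfolding c_def d_def by blast
        also have "\<dots> \<subseteq> G" using r(2) hi(2)[OF that] by blast
        finally show ?thesis .
      qed
      have disj: "disjoint_family_on (\<lambda>i. {c i<..<d i}) {..<n}"
        unfolding disjoint_family_on_def
      proof (intro ballI impI)
        fix i j assume ij: "i \<in> {..<n}" "j \<in> {..<n}" "i \<noteq> j"
        then have "h i \<noteq> h j"
          using h by (auto simp: bij_betw_def inj_on_def)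
        then have "(fst (h i), snd (h i)) \<noteq> (fst (h j), snd (h j))" by simp
        then have "interior (snd (h i)) \<inter> interior (snd (h j)) = {}"
          using tagged_division_ofD(5)[OF p(1) hi(1) hi(1)] ij by blast
        moreover have "interior (snd (h k)) = {c k<..<d k}" if "k < n" for k
        proof -
          have "snd (h k) = {c k..d k}"
            using piece[OF hi(1)[OF that]] unfolding c_def d_def by blast
          then show ?thesis by simp
        qed
        ultimately show "{c i<..<d i} \<inter> {c j<..<d j} = {}" using ij by auto
      qed
      have "ennreal (\<Sum>i<n. d i - c i) = (\<Sum>i<n. ennreal (d i - c i))"
        using sub by (subst sum_ennreal) auto
      also have "\<dots> = (\<Sum>i<n. emeasure lebesgue {c i<..<d i})"
        using sub by (intro sum.cong) auto
      also have "\<dots> = emeasure lebesgue (\<Union>i<n. {c i<..<d i})"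
        using disj by (intro sum_emeasure) auto
      also have "\<dots> \<le> emeasure lebesgue G"
        using inG G(1) by (intro emeasure_mono) auto
      also have "\<dots> < ennreal \<delta>" by (rule emG)
      finally have "(\<Sum>i<n. d i - c i) < \<delta>"
        using sub by (subst (asm) ennreal_less_iff) (auto intro!: sum_nonneg)
      from \<delta>(2)[OF sub disj this] have "(\<Sum>i<n. norm (f (d i) - f (c i))) < \<epsilon>" by simp
      also have "(\<Sum>i<n. norm (f (d i) - f (c i))) = (\<Sum>i<n. ?d (h i))"
        by (simp add: c_def d_def case_prod_beta)
      also have "\<dots> = sum ?d q" by (rule sum.reindex_bij_betw[OF h])
      finally show ?thesis .
    qed
    moreover have "sum ?d (p - q) \<le> \<epsilon> * (b - a)"
    proof -
      have "?d z \<le> \<epsilon> * (Sup (snd z) - Inf (snd z))" if z: "z \<in> p - q" for z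
      proof -
        obtain x K where zx: "z = (x, K)" by (cases z)
        have xK: "(x, K) \<in> p" and xN: "x \<notin> N" using z by (auto simp: zx q_def)
        note e = ends[OF xK]
        have le: "Inf K \<le> x" "x \<le> Sup K" using piece[OF xK] by auto
        have "norm (f (Sup K) - f (Inf K)) \<le> norm (f (Sup K) - f x) + norm (f (Inf K) - f x)"
          by (metis dist_norm dist_triangle2)
        also have "\<dots> \<le> \<epsilon> * \<bar>Sup K - x\<bar> + \<epsilon> * \<bar>Inf K - x\<bar>"
          using e xN by (intro add_mono r(3)) auto
        also have "\<dots> = \<epsilon> * (Sup K - Inf K)"
          using le by (simp add: algebra_simps)
        finally show ?thesis by (simp add: zx)
      qed
      then have "sum ?d (p - q) \<le> (\<Sum>z\<in>p - q. \<epsilon> * (Sup (snd z) - Inf (snd z)))"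
        by (rule sum_mono)
      also have "\<dots> \<le> (\<Sum>z\<in>p. \<epsilon> * (Sup (snd z) - Inf (snd z)))"
      proof (rule sum_mono2[OF fin])
        show "p - q \<subseteq> p" by auto
        show "0 \<le> \<epsilon> * (Sup (snd z) - Inf (snd z))" if "z \<in> p - (p - q)" for z
        proof -
          have "Inf (snd z) \<le> fst z" "fst z \<le> Sup (snd z)"
            using piece[of "fst z" "snd z"] that by auto
          then show ?thesis using \<open>\<epsilon> > 0\<close> by simp
        qed
      qed
      also have "\<dots> = \<epsilon> * (\<Sum>(x, K)\<in>p. Sup K - Inf K)"
        by (simp add: sum_distrib_left case_prod_beta)
      also have "\<dots> = \<epsilon> * (b - a)"
        using additive_tagged_division_1[OF \<open>a \<le> b\<close> p(1), of "\<lambda>x. x"] by simp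
      finally show ?thesis .
    qed
    moreover have "norm (f b - f a) \<le> sum ?d p"
      unfolding additive_tagged_division_1[OF \<open>a \<le> b\<close> p(1), of f, symmetric]
      by (rule order_trans[OF norm_sum]) (auto intro!: sum_mono)
    moreover have "sum ?d p = sum ?d (p - q) + sum ?d q"
      by (rule sum.subset_diff[OF qp fin])
    ultimately show ?thesis by (simp add: algebra_simps)
  qed
  have "norm (f b - f a) \<le> 0 + e" if "e > 0" for e
    using bound[of "e / (b - a + 1)"] that \<open>a \<le> b\<close> by simp
  then have "norm (f b - f a) \<le> 0" by (rule field_le_epsilon)
  then show ?thesis by simp
qed

lemma lipschitz_on_C1:
  fixes f :: "real \<Rightarrow> 'a::real_normed_vector"
  assumes der: "\<And>t. t \<in> {a..b} \<Longrightarrow> (f has_vector_derivative \<phi> t) (at t within {a..b})"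
    and cont: "continuous_on {a..b} \<phi>"
  shows "\<exists>L. L-lipschitz_on {a..b} f"
proof -
  have "bounded (\<phi> ` {a..b})"
    using cont by (intro compact_imp_bounded compact_continuous_image) auto
  then obtain C where C: "C > 0" "\<And>t. t \<in> {a..b} \<Longrightarrow> norm (\<phi> t) \<le> C"
    by (auto simp: bounded_pos)
  have "C-lipschitz_on {a..b} f"
  proof (rule bounded_derivative_imp_lipschitz)
    show "(f has_derivative (\<lambda>h. h *\<^sub>R \<phi> t)) (at t within {a..b})" if "t \<in> {a..b}" for t
      using der[OF that] by (simp add: has_vector_derivative_def)
    show "onorm (\<lambda>h. h *\<^sub>R \<phi> t) \<le> C" if "t \<in> {a..b}" for t
      using C(2)[OF that] by (simp add: onorm_scaleR_left onorm_id)
  qed (use C in auto)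
  then show ?thesis by blast
qed

text \<open>This turns the equations of the extremal, which hold almost everywhere, into classical
  differential equations: the difference of \<open>f\<close> and a primitive of \<open>\<phi>\<close> is absolutely continuous
  with derivative zero almost everywhere, hence constant.\<close>

theorem vector_absolutely_continuous_on_AE_derivative_continuous:
  fixes f :: "real \<Rightarrow> 'a::banach"
  assumes ac: "\<And>a b. vector_absolutely_continuous_on {a..b} f"
    and ae: "AE t in lebesgue. (f has_vector_derivative \<phi> t) (at t)"
    and cont: "continuous_on UNIV \<phi>"
  shows "(f has_vector_derivative \<phi> t) (at t)"
proof -
  define a where "a = t - 1"
  define b where "b = t + 1"
  define \<Phi> where "\<Phi> s = integral {a..s} \<phi>" for s
  have cab: "continuous_on S \<phi>" for S
    using cont continuous_on_subset by blast
  have \<Phi>: "(\<Phi> has_vector_derivative \<phi> s) (at s within {a..b})" if "s \<in> {a..b}" for s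
    unfolding \<Phi>_def using integral_has_vector_derivative[OF cab that] .
  have eq: "f s = f a + \<Phi> s" if s: "s \<in> {a..b}" for s
  proof -
    obtain L where "L-lipschitz_on {a..b} \<Phi>"
      using lipschitz_on_C1[of a b \<Phi> \<phi>, OF \<Phi> cab] by auto
    then have "vector_absolutely_continuous_on {a..b} (\<lambda>s. f s - \<Phi> s)"
      by (rule vector_absolutely_continuous_on_diff[OF ac vector_absolutely_continuous_on_lipschitz])
    then have "vector_absolutely_continuous_on {a..s} (\<lambda>s. f s - \<Phi> s)"
      by (rule vector_absolutely_continuous_on_subset) (use s in auto)
    moreover have "AE r in lebesgue. r \<in> {a..s} \<longrightarrow>
        ((\<lambda>s. f s - \<Phi> s) has_vector_derivative 0) (at r within {a..s})"
      using ae
    proof (rule AE_mp, intro AE_I2 impI)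
      fix r assume f: "(f has_vector_derivative \<phi> r) (at r)" and r: "r \<in> {a..s}"
      have "(f has_vector_derivative \<phi> r) (at r within {a..s})"
        by (rule has_vector_derivative_at_within[OF f])
      moreover have "(\<Phi> has_vector_derivative \<phi> r) (at r within {a..s})"
        by (rule has_vector_derivative_within_subset[OF \<Phi>]) (use r s in auto)
      ultimately show "((\<lambda>s. f s - \<Phi> s) has_vector_derivative 0) (at r within {a..s})"
        using has_vector_derivative_diff[of f "\<phi> r" _ \<Phi> "\<phi> r"] by simp
    qed
    ultimately have "f s - \<Phi> s = f a - \<Phi> a"
      using s by (intro vector_absolutely_continuous_on_deriv_zero) auto
    then show ?thesis by (simp add: \<Phi>_def algebra_simps)
  qed
  have t: "t \<in> {a..b}" "t \<in> {a<..<b}" by (auto simp: a_def b_def)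
  have "((\<lambda>s. f a + \<Phi> s) has_vector_derivative \<phi> t) (at t within {a..b})"
    using has_vector_derivative_add[OF has_vector_derivative_const \<Phi>[OF t(1)]] by simp
  then have "(f has_vector_derivative \<phi> t) (at t within {a..b})"
    by (rule has_vector_derivative_transform[OF t(1), rotated]) (rule eq)
  then have "(f has_vector_derivative \<phi> t) (at t within {a<..<b})"
    by (rule has_vector_derivative_within_subset) auto
  then show ?thesis
    by (rule iffD1[OF has_vector_derivative_within_open[OF t(2) open_greaterThanLessThan]])
qed

text \<open>The set where two continuous functions differ is open, and an open null set is empty.\<close>

lemma AE_continuous_imp_eq:
  fixes f g :: "real \<Rightarrow> 'a::{t2_space}"
  assumes "AE t in lebesgue. f t = g t" "continuous_on UNIV f" "continuous_on UNIV g"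
  shows "f = g"
proof -
  have "open {t. f t \<noteq> g t}"
    using assms(2,3) by (rule open_Collect_neq)
  moreover have "negligible {t. f t \<noteq> g t}"
    using assms(1) negligible_subset unfolding eventually_ae_filter_negligible by metis
  ultimately have "{t. f t \<noteq> g t} = {}"
    using open_not_negligible by blast
  then show ?thesis by auto
qed


section \<open>The exponential of complex two by two matrices\<close>

lemma cmat2_mult_nth: "((A::cmat2) ** B)$i$j = A$i$1 * B$1$j + A$i$2 * B$2$j"
  by (simp add: matrix_matrix_mult_def sum_2)

lemma bounded_bilinear_cmat2_mult: "bounded_bilinear ((**) :: cmat2 \<Rightarrow> cmat2 \<Rightarrow> cmat2)"
proof -
  have "bilinear ((**) :: cmat2 \<Rightarrow> cmat2 \<Rightarrow> cmat2)"
    unfolding bilinear_def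
    by (auto intro!: linearI simp: vec_eq_iff cmat2_mult_nth algebra_simps)
  then show ?thesis by (simp add: bilinear_conv_bounded_bilinear)
qed

interpretation cmat2_mult: bounded_bilinear "(**) :: cmat2 \<Rightarrow> cmat2 \<Rightarrow> cmat2"
  by (rule bounded_bilinear_cmat2_mult)

lemma bounded_linear_cmat2_nth: "bounded_linear (\<lambda>X::cmat2. X$i$j)"
  by (rule bounded_linear_compose[OF bounded_linear_vec_nth bounded_linear_vec_nth])

lemma has_vector_derivative_cmat2:
  fixes f :: "real \<Rightarrow> cmat2"
  assumes "\<And>i j. ((\<lambda>t. f t $ i $ j) has_vector_derivative f' $ i $ j) (at t within S)"
  shows "(f has_vector_derivative f') (at t within S)"
  unfolding has_vector_derivative_def
proof (rule iffD2[OF has_derivative_componentwise_within], rule ballI)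
  fix b :: cmat2 assume "b \<in> Basis"
  then obtain i j c where b: "b = axis i (axis j c)"
    unfolding Basis_vec_def by blast
  have "((\<lambda>t. f t $ i $ j \<bullet> c) has_vector_derivative (f' $ i $ j \<bullet> c)) (at t within S)"
    by (rule bounded_linear.has_vector_derivative[OF bounded_linear_inner_left assms])
  then show "((\<lambda>t. f t \<bullet> b) has_derivative (\<lambda>h. (h *\<^sub>R f') \<bullet> b)) (at t within S)"
    by (simp add: b inner_axis has_vector_derivative_def)
qed

lemma matrix_power_0: "matrix_power A 0 = mat 1"
  by (simp add: matrix_power_def)

lemma matrix_power_Suc: "matrix_power A (Suc n) = A ** matrix_power A n"
  by (simp add: matrix_power_def)

lemma matrix_power_Suc2: "matrix_power A (Suc n) = matrix_power A n ** A"
proof (induction n)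
  case (Suc n)
  then show ?case by (metis matrix_mul_assoc matrix_power_Suc)
qed (simp add: matrix_power_0 matrix_power_Suc)

lemma matrix_power_scaleR: "matrix_power (t *\<^sub>R A) n = t ^ n *\<^sub>R matrix_power A n"
  by (induction n)
    (simp_all add: matrix_power_0 matrix_power_Suc cmat2_mult.scaleR_left cmat2_mult.scaleR_right)

lemma summable_norm_matrix_exp: "summable (\<lambda>n. norm (matrix_power A n /\<^sub>R fact n))"
proof -
  obtain K where "K > 0 \<and> (\<forall>(A::cmat2) B::cmat2. norm (A ** B) \<le> norm A * norm B * K)"
    using cmat2_mult.pos_bounded ..
  then have K: "K > 0" "\<And>(A::cmat2) B::cmat2. norm (A ** B) \<le> norm A * norm B * K" by simp_all
  have pow: "norm (matrix_power A n) \<le> norm (mat 1 :: cmat2) * (norm A * K) ^ n" for n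
  proof (induction n)
    case 0 then show ?case by (simp add: matrix_power_0)
  next
    case (Suc n)
    have "norm (matrix_power A (Suc n)) \<le> norm A * norm (matrix_power A n) * K"
      by (simp add: matrix_power_Suc K(2))
    also have "\<dots> \<le> norm A * (norm (mat 1 :: cmat2) * (norm A * K) ^ n) * K"
      using K(1) by (intro mult_right_mono mult_left_mono Suc.IH) auto
    finally show ?case by (simp add: mult_ac)
  qed
  show ?thesis
  proof (rule summable_comparison_test)
    show "summable (\<lambda>n. norm (mat 1 :: cmat2) * (inverse (fact n) * (norm A * K) ^ n))"
      by (intro summable_mult summable_exp)
    have "norm (norm (matrix_power A n /\<^sub>R fact n)) \<le> norm (mat 1 :: cmat2) * (inverse (fact n) * (norm A * K) ^ n)" for n
      using mult_left_mono[OF pow[of n], of "inverse (fact n)"] by (simp add: mult_ac)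
    then show "\<exists>N. \<forall>n\<ge>N. norm (norm (matrix_power A n /\<^sub>R fact n))
        \<le> norm (mat 1 :: cmat2) * (inverse (fact n) * (norm A * K) ^ n)"
      by blast
  qed
qed

lemma summable_matrix_exp: "summable (\<lambda>n. matrix_power A n /\<^sub>R fact n)"
  by (rule summable_norm_cancel[OF summable_norm_matrix_exp])

lemma matrix_exp_sums: "(\<lambda>n. matrix_power A n /\<^sub>R fact n) sums matrix_exp A"
  unfolding matrix_exp_def by (rule summable_sums[OF summable_matrix_exp])

lemma matrix_exp_commute: "A ** matrix_exp (t *\<^sub>R A) = matrix_exp (t *\<^sub>R A) ** A"
proof -
  have "(\<lambda>n. A ** (matrix_power (t *\<^sub>R A) n /\<^sub>R fact n)) sums (A ** matrix_exp (t *\<^sub>R A))"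
    by (rule bounded_linear.sums[OF cmat2_mult.bounded_linear_right matrix_exp_sums])
  moreover have "(\<lambda>n. (matrix_power (t *\<^sub>R A) n /\<^sub>R fact n) ** A) sums (matrix_exp (t *\<^sub>R A) ** A)"
    by (rule bounded_linear.sums[OF cmat2_mult.bounded_linear_left matrix_exp_sums])
  moreover have "A ** (matrix_power (t *\<^sub>R A) n /\<^sub>R fact n) = (matrix_power (t *\<^sub>R A) n /\<^sub>R fact n) ** A" for n
    by (simp add: matrix_power_scaleR cmat2_mult.scaleR_left cmat2_mult.scaleR_right
        flip: matrix_power_Suc matrix_power_Suc2)
  ultimately show ?thesis by (simp add: sums_unique2)
qed

text \<open>Each entry of the exponential is an ordinary complex power series in \<open>t\<close>, so it can be
  differentiated termwise.\<close>

lemma has_vector_derivative_matrix_exp: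
  "((\<lambda>t. matrix_exp (t *\<^sub>R A)) has_vector_derivative A ** matrix_exp (t *\<^sub>R A)) (at t)"
proof (rule has_vector_derivative_cmat2)
  fix i j :: 2
  define c where "c n = matrix_power A n $ i $ j / fact n" for n
  have entry: "(\<lambda>n. c n * complex_of_real s ^ n) sums (matrix_exp (s *\<^sub>R A) $ i $ j)" for s
  proof -
    have "(matrix_power (s *\<^sub>R A) n /\<^sub>R fact n) $ i $ j = c n * complex_of_real s ^ n" for n
      unfolding matrix_power_scaleR c_def vector_scaleR_component
      by (simp add: scaleR_conv_of_real field_simps)
    then show ?thesis
      using bounded_linear.sums[OF bounded_linear_cmat2_nth matrix_exp_sums[of "s *\<^sub>R A"], of i j]
      by (simp only:)
  qed
  have summ: "summable (\<lambda>n. c n * z ^ n)" for z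
  proof (rule summable_norm_cancel)
    obtain K where K: "\<And>X :: cmat2. norm (X$i$j) \<le> norm X * K"
      using bounded_linear.bounded[OF bounded_linear_cmat2_nth[of i j]] by auto
    have "norm (c n * z ^ n) \<le> norm (matrix_power (norm z *\<^sub>R A) n /\<^sub>R fact n) * K" for n
      using mult_right_mono[OF K[of "matrix_power A n"], of "norm z ^ n / fact n"]
      by (simp add: c_def matrix_power_scaleR norm_mult norm_power norm_divide field_simps)
    then show "summable (\<lambda>n. norm (c n * z ^ n))"
      by (intro summable_comparison_test[OF _ summable_mult2[OF summable_norm_matrix_exp]]) auto
  qed
  have "((\<lambda>z. \<Sum>n. c n * z ^ n) has_field_derivative (\<Sum>n. diffs c n * complex_of_real t ^ n)) (at (complex_of_real t))"
    using termdiffs_strong_converges_everywhere[OF summ] .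
  then have "((\<lambda>s. \<Sum>n. c n * complex_of_real s ^ n) has_vector_derivative (\<Sum>n. diffs c n * complex_of_real t ^ n)) (at t)"
    by (rule has_vector_derivative_real_field)
  moreover have "(\<lambda>s. \<Sum>n. c n * complex_of_real s ^ n) = (\<lambda>s. matrix_exp (s *\<^sub>R A) $ i $ j)"
    using sums_unique[OF entry] by auto
  moreover have "(\<Sum>n. diffs c n * complex_of_real t ^ n) = (A ** matrix_exp (t *\<^sub>R A)) $ i $ j"
  proof -
    have "(\<lambda>n. (A ** (matrix_power (t *\<^sub>R A) n /\<^sub>R fact n)) $ i $ j) sums (A ** matrix_exp (t *\<^sub>R A)) $ i $ j"
      by (rule bounded_linear.sums[OF bounded_linear_cmat2_nth
          bounded_linear.sums[OF cmat2_mult.bounded_linear_right matrix_exp_sums]])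
    moreover have "(A ** (matrix_power (t *\<^sub>R A) n /\<^sub>R fact n)) $ i $ j = diffs c n * complex_of_real t ^ n" for n
    proof -
      have "(A ** (matrix_power (t *\<^sub>R A) n /\<^sub>R fact n)) = (t ^ n / fact n) *\<^sub>R matrix_power A (Suc n)"
        by (simp add: matrix_power_scaleR matrix_power_Suc cmat2_mult.scaleR_right field_simps)
      moreover have "diffs c n = matrix_power A (Suc n) $ i $ j / fact n"
        by (simp add: diffs_def c_def del: of_nat_Suc)
      ultimately show ?thesis
        by (simp only: vector_scaleR_component) (simp add: scaleR_conv_of_real)
    qed
    ultimately show ?thesis by (simp add: sums_iff)
  qed
  ultimately show "((\<lambda>t. matrix_exp (t *\<^sub>R A) $ i $ j) has_vector_derivative (A ** matrix_exp (t *\<^sub>R A)) $ i $ j) (at t)"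
    by simp
qed

lemma has_vector_derivative_matrix_exp_minus:
  "((\<lambda>t. matrix_exp ((- t) *\<^sub>R A)) has_vector_derivative - (A ** matrix_exp ((- t) *\<^sub>R A))) (at t)"
proof -
  have "((\<lambda>t. matrix_exp (t *\<^sub>R (- A))) has_vector_derivative (- A) ** matrix_exp (t *\<^sub>R (- A))) (at t)"
    by (rule has_vector_derivative_matrix_exp)
  then show ?thesis by (simp add: cmat2_mult.minus_left)
qed

lemma matrix_exp_0 [simp]: "matrix_exp 0 = mat 1"
proof -
  have "matrix_power 0 n /\<^sub>R fact n = (if n = 0 then mat 1 else 0)" for n
    by (cases n) (simp_all add: matrix_power_0 matrix_power_Suc cmat2_mult.zero_left)
  then have "(\<lambda>n. matrix_power 0 n /\<^sub>R fact n) sums mat 1"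
    using sums_single[of 0 "\<lambda>_. mat 1 :: cmat2"] by simp
  then show ?thesis
    using matrix_exp_sums sums_unique2 by blast
qed

lemma has_vector_derivative_zero_eq:
  fixes f :: "real \<Rightarrow> 'a::real_normed_vector"
  assumes "\<And>t. (f has_vector_derivative 0) (at t)"
  shows "f t = f 0"
  using has_vector_derivative_zero_constant[of UNIV f] assms by (metis UNIV_I convex_UNIV)

lemma matrix_exp_minus_left: "matrix_exp ((- t) *\<^sub>R A) ** matrix_exp (t *\<^sub>R A) = mat 1"
proof -
  let ?E = "\<lambda>t. matrix_exp (t *\<^sub>R A)" and ?F = "\<lambda>t. matrix_exp ((- t) *\<^sub>R A)"
  have "((\<lambda>t. ?F t ** ?E t) has_vector_derivative 0) (at t)" for t
  proof -
    have "((\<lambda>t. ?F t ** ?E t) has_vector_derivative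
        ?F t ** (A ** ?E t) + (- (A ** ?F t)) ** ?E t) (at t)"
      by (intro cmat2_mult.has_vector_derivative has_vector_derivative_matrix_exp
          has_vector_derivative_matrix_exp_minus)
    moreover have "?F t ** (A ** ?E t) + (- (A ** ?F t)) ** ?E t = 0"
      by (simp add: matrix_exp_commute[of A "- t"] cmat2_mult.minus_left matrix_mul_assoc del: scaleR_minus_left)
    ultimately show ?thesis by (simp only:)
  qed
  from has_vector_derivative_zero_eq[OF this] show ?thesis by simp
qed

lemma matrix_exp_minus_right: "matrix_exp (t *\<^sub>R A) ** matrix_exp ((- t) *\<^sub>R A) = mat 1"
  using matrix_exp_minus_left[of "- t" A] by simp

lemma has_vector_derivative_conj_matrix_exp:
  "((\<lambda>t. matrix_exp (t *\<^sub>R B) ** X ** matrix_exp ((- t) *\<^sub>R B)) has_vector_derivative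
    lie_bracket B (matrix_exp (t *\<^sub>R B) ** X ** matrix_exp ((- t) *\<^sub>R B))) (at t)"
proof -
  let ?E = "\<lambda>t. matrix_exp (t *\<^sub>R B)" and ?F = "\<lambda>t. matrix_exp ((- t) *\<^sub>R B)"
  have "((\<lambda>t. ?E t ** X ** ?F t) has_vector_derivative
        (?E t ** X) ** (- (B ** ?F t)) + (?E t ** 0 + (B ** ?E t) ** X) ** ?F t) (at t)"
    by (intro cmat2_mult.has_vector_derivative has_vector_derivative_matrix_exp
        has_vector_derivative_matrix_exp_minus has_vector_derivative_const)
  moreover have "(?E t ** X) ** (- (B ** ?F t)) + (?E t ** 0 + (B ** ?E t) ** X) ** ?F t
      = lie_bracket B (?E t ** X ** ?F t)"
    unfolding lie_bracket_def matrix_exp_commute[of B "- t"]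
    by (simp add: cmat2_mult.minus_right cmat2_mult.zero_right matrix_mul_assoc del: scaleR_minus_left)
  ultimately show ?thesis by (simp only:)
qed

text \<open>Uniqueness for the linear equation \<open>X' = [B, X]\<close>: conjugating a solution back by the
  exponentials gives a curve with derivative zero. It is used for the optimal control, and again
  to see that conjugation by the exponential of a skew-Hermitian matrix preserves Hermitian
  matrices.\<close>

lemma lie_bracket_ode_unique:
  assumes X: "\<And>t. (X has_vector_derivative lie_bracket B (X t)) (at t)"
  shows "X t = matrix_exp (t *\<^sub>R B) ** X 0 ** matrix_exp ((- t) *\<^sub>R B)"
proof -
  let ?E = "\<lambda>t. matrix_exp (t *\<^sub>R B)" and ?F = "\<lambda>t. matrix_exp ((- t) *\<^sub>R B)"
  have "((\<lambda>t. ?F t ** X t ** ?E t) has_vector_derivative 0) (at t)" for t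
  proof -
    have "((\<lambda>t. ?F t ** X t ** ?E t) has_vector_derivative
        (?F t ** X t) ** (B ** ?E t) + (?F t ** lie_bracket B (X t) + (- (B ** ?F t)) ** X t) ** ?E t) (at t)"
      by (intro cmat2_mult.has_vector_derivative has_vector_derivative_matrix_exp
          has_vector_derivative_matrix_exp_minus X)
    moreover have "(?F t ** X t) ** (B ** ?E t) + (?F t ** lie_bracket B (X t) + (- (B ** ?F t)) ** X t) ** ?E t = 0"
      unfolding lie_bracket_def matrix_exp_commute[of B "- t"]
      by (simp add: cmat2_mult.minus_left cmat2_mult.diff_right cmat2_mult.diff_left cmat2_mult.add_left
          matrix_mul_assoc del: scaleR_minus_left)
    ultimately show ?thesis by (simp only:)
  qed
  then have "?F t ** X t ** ?E t = X 0"
    using has_vector_derivative_zero_eq[of "\<lambda>t. ?F t ** X t ** ?E t" t] by simp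
  then have "?E t ** X 0 ** ?F t = (?E t ** ?F t) ** X t ** (?E t ** ?F t)"
    by (metis matrix_mul_assoc)
  then show ?thesis
    unfolding matrix_exp_minus_right by simp
qed


section \<open>Hermitian matrices and the Lorentz product\<close>

lemma Herm_coord_simps:
  "Herm_coord 0 h = Re (h$1$1) + Re (h$2$2)"
  "Herm_coord 1 h = Re (h$1$2) + Re (h$2$1)"
  "Herm_coord 2 h = Im (h$1$2) - Im (h$2$1)"
  "Herm_coord 3 h = Re (h$1$1) - Re (h$2$2)"
  by (simp_all add: Herm_coord_def trace_def cmat2_mult_nth sum_2 gl_basis_nth del: One_nat_def)

lemma pseudo_inner_coords:
  "pseudo_inner h k = Herm_coord 0 h * Herm_coord 0 k
    - (Herm_coord 1 h * Herm_coord 1 k + Herm_coord 2 h * Herm_coord 2 k + Herm_coord 3 h * Herm_coord 3 k)"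
  by (simp only: pseudo_inner_def sum_1_3)

lemma Herm_coord_add: "Herm_coord i (h + k) = Herm_coord i h + Herm_coord i k"
  by (simp add: Herm_coord_def cmat2_mult.add_left trace_add distrib_left)

lemma Herm_coord_scaleR: "Herm_coord i (c *\<^sub>R h) = c * Herm_coord i h"
  by (simp add: Herm_coord_def cmat2_mult.scaleR_left trace_def sum_2 algebra_simps)

lemma pseudo_inner_scaleR: "pseudo_inner (c *\<^sub>R h) (c *\<^sub>R h) = c\<^sup>2 * pseudo_inner h h"
  by (simp add: pseudo_inner_coords Herm_coord_scaleR power2_eq_square algebra_simps)

lemma pseudo_inner_line:
  "pseudo_inner (u + s *\<^sub>R w) (u + s *\<^sub>R w)
    = pseudo_inner u u + 2 * s * pseudo_inner u w + s\<^sup>2 * pseudo_inner w w"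
  by (simp add: pseudo_inner_coords Herm_coord_scaleR Herm_coord_add power2_eq_square algebra_simps)

lemma Herm_coord_gl_basis:
  "Herm_coord 0 (gl_basis 0) = 1" "Herm_coord 0 (gl_basis 1) = 0" "Herm_coord 0 (gl_basis 2) = 0" "Herm_coord 0 (gl_basis 3) = 0"
  "Herm_coord 1 (gl_basis 0) = 0" "Herm_coord 1 (gl_basis 1) = 1" "Herm_coord 1 (gl_basis 2) = 0" "Herm_coord 1 (gl_basis 3) = 0"
  "Herm_coord 2 (gl_basis 0) = 0" "Herm_coord 2 (gl_basis 1) = 0" "Herm_coord 2 (gl_basis 2) = 1" "Herm_coord 2 (gl_basis 3) = 0"
  "Herm_coord 3 (gl_basis 0) = 0" "Herm_coord 3 (gl_basis 1) = 0" "Herm_coord 3 (gl_basis 2) = 0" "Herm_coord 3 (gl_basis 3) = 1"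
  by (simp_all add: Herm_coord_simps gl_basis_nth del: One_nat_def)

lemma pseudo_inner_e0: "pseudo_inner h (gl_basis 0) = Herm_coord 0 h"
  by (simp add: pseudo_inner_coords Herm_coord_gl_basis del: One_nat_def)

lemma Herm_subset_gl_plus: "Herm \<subseteq> gl_plus"
  unfolding Herm_def gl_plus_eq by (intro span_mono image_mono) auto

lemma subspace_Herm: "subspace Herm"
  unfolding Herm_def by (rule subspace_span)

lemma subspace_gl_plus: "subspace gl_plus"
  unfolding gl_plus_eq by (rule subspace_span)

lemma gl_basis_in_gl_plus: "i \<le> 6 \<Longrightarrow> gl_basis i \<in> gl_plus"
  unfolding gl_plus_eq by (auto intro: span_base)

lemma gl_basis_in_Herm: "i \<le> 3 \<Longrightarrow> gl_basis i \<in> Herm"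
  unfolding Herm_def by (auto intro: span_base)

lemma lie_bracket_in_gl_plus: "lie_bracket A B \<in> gl_plus"
  by (simp add: gl_plus_def lie_bracket_def trace_sub trace_mul_sym[of A B])

lemma Herm_expand:
  assumes "h \<in> Herm"
  shows "h = Herm_coord 0 h *\<^sub>R gl_basis 0 + Herm_coord 1 h *\<^sub>R gl_basis 1
    + Herm_coord 2 h *\<^sub>R gl_basis 2 + Herm_coord 3 h *\<^sub>R gl_basis 3"
  using assms unfolding Herm_eq cmat2_eq_iff
  by (simp add: Herm_coord_simps gl_basis_nth complex_eq_iff field_simps del: One_nat_def)

section \<open>Covectors that attain their minimum on the control set\<close>

text \<open>Lagrange multipliers by hand. For small \<open>s\<close>, the vector \<open>u + s w\<close> divided by its Lorentz norm is
  in the control set, so \<open>\<phi> u + s \<phi> w \<ge> \<phi> u * sqrt \<langle>u + s w, u + s w\<rangle>\<close>, with equality at \<open>s = 0\<close>.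
  Comparing derivatives at \<open>s = 0\<close> gives the result.\<close>

lemma minimizer_imp_multiple_of_pseudo_inner:
  assumes \<phi>: "\<phi> \<in> gl_plus_dual"
    and u: "u \<in> Herm" "pseudo_inner u u = 1" "pseudo_inner u (gl_basis 0) > 0"
    and min: "\<And>v. v \<in> control_set \<Longrightarrow> \<phi> u \<le> \<phi> v"
    and w: "w \<in> Herm"
  shows "\<phi> w = \<phi> u * pseudo_inner u w"
proof -
  define b where "b = pseudo_inner u w"
  define c where "c = pseudo_inner w w"
  define q where "q s = 1 + 2 * s * b + s\<^sup>2 * c" for s
  define r where "r s = Herm_coord 0 u + s * Herm_coord 0 w" for s
  have "(q \<longlongrightarrow> q 0) (at 0)" "(r \<longlongrightarrow> r 0) (at 0)"
    unfolding q_def r_def by (auto intro!: tendsto_eq_intros)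
  moreover have "q 0 > 0" "r 0 > 0"
    using u(3) by (simp_all add: q_def r_def pseudo_inner_e0)
  ultimately have "eventually (\<lambda>s. q s > 0 \<and> r s > 0) (at 0)"
    by (auto intro: eventually_conj order_tendstoD)
  then obtain d where d: "d > 0" "\<And>s. s \<noteq> 0 \<Longrightarrow> \<bar>s\<bar> < d \<Longrightarrow> q s > 0 \<and> r s > 0"
    unfolding eventually_at by (auto simp: dist_real_def)
  have pos: "q s > 0" "r s > 0" if "\<bar>s\<bar> < d" for s
    using d(2)[of s] \<open>q 0 > 0\<close> \<open>r 0 > 0\<close> that by (cases "s = 0"; simp)+
  have lin: "\<phi> (x + y) = \<phi> x + \<phi> y" "\<phi> (k *\<^sub>R x) = k * \<phi> x" if "x \<in> Herm" "y \<in> Herm" for x y k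
    using \<phi> Herm_subset_gl_plus that unfolding gl_plus_dual_def by blast+
  let ?f = "\<lambda>s. \<phi> u + s * \<phi> w - \<phi> u * sqrt (q s)"
  have "?f 0 \<le> ?f s" if s: "\<bar>0 - s\<bar> < d" for s
  proof -
    have qr: "q s > 0" "r s > 0" using pos that by auto
    have us: "u + s *\<^sub>R w \<in> Herm" "s *\<^sub>R w \<in> Herm"
      using u(1) w subspace_Herm by (auto intro: subspace_add subspace_scale)
    define v where "v = (1 / sqrt (q s)) *\<^sub>R (u + s *\<^sub>R w)"
    have "v \<in> Herm" unfolding v_def using us subspace_Herm by (auto intro: subspace_scale)
    moreover have "pseudo_inner v v = 1"
      using qr(1) u(2) unfolding v_def pseudo_inner_scaleR pseudo_inner_line
      by (simp add: q_def b_def c_def power_divide)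
    moreover have "pseudo_inner v (gl_basis 0) > 0"
      using qr by (simp add: v_def pseudo_inner_e0 Herm_coord_scaleR Herm_coord_add r_def)
    ultimately have "\<phi> u \<le> \<phi> v"
      by (intro min) (simp add: control_set_def)
    also have "\<phi> v = (\<phi> u + s * \<phi> w) / sqrt (q s)"
      unfolding v_def using u(1) w us by (simp add: lin)
    finally have "\<phi> u * sqrt (q s) \<le> \<phi> u + s * \<phi> w"
      using qr(1) by (simp add: pos_le_divide_eq)
    then show ?thesis by (simp add: q_def)
  qed
  moreover have "(?f has_real_derivative \<phi> w - \<phi> u * b) (at 0)"
    unfolding q_def by (auto intro!: derivative_eq_intros)
  ultimately have "\<phi> w - \<phi> u * b = 0"
    using d(1) by (intro DERIV_local_min[of ?f]) auto
  then show ?thesis by (simp add: b_def)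
qed

text \<open>The coefficients are the coordinates of \<open>A\<close> with respect to the real basis of \<^const>\<open>gl_plus\<close>.\<close>

lemma gl_plus_dual_expand:
  assumes "\<phi> \<in> gl_plus_dual" "A \<in> gl_plus"
  shows "\<phi> A = Re (A$1$1 + A$2$2) * \<phi> (gl_basis 0) + Re (A$1$2 + A$2$1) * \<phi> (gl_basis 1)
    + Im (A$1$2 - A$2$1) * \<phi> (gl_basis 2) + Re (A$1$1 - A$2$2) * \<phi> (gl_basis 3)
    + Im (A$1$2 + A$2$1) * \<phi> (gl_basis 4) + Re (A$2$1 - A$1$2) * \<phi> (gl_basis 5)
    + Im (A$1$1 - A$2$2) * \<phi> (gl_basis 6)"
proof -
  have A: "Im (A$2$2) = - Im (A$1$1)"
    using assms(2) by (simp add: gl_plus_def trace_def sum_2 complex_is_Real_iff)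
  have add: "\<phi> (x + y) = \<phi> x + \<phi> y" if "x \<in> gl_plus" "y \<in> gl_plus" for x y
    using assms(1) that unfolding gl_plus_dual_def by blast
  have scale: "\<phi> (c *\<^sub>R x) = c * \<phi> x" if "x \<in> gl_plus" for x c
    using assms(1) that unfolding gl_plus_dual_def by blast
  have closed: "x + y \<in> gl_plus" if "x \<in> gl_plus" "y \<in> gl_plus" for x y
    using that subspace_gl_plus by (auto intro: subspace_add)
  have closed': "c *\<^sub>R x \<in> gl_plus" if "x \<in> gl_plus" for x c
    using that subspace_gl_plus by (auto intro: subspace_scale)
  have basis: "gl_basis 0 \<in> gl_plus" "gl_basis 1 \<in> gl_plus" "gl_basis 2 \<in> gl_plus"
    "gl_basis 3 \<in> gl_plus" "gl_basis 4 \<in> gl_plus" "gl_basis 5 \<in> gl_plus" "gl_basis 6 \<in> gl_plus"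
    by (simp_all add: gl_basis_in_gl_plus)
  have "A = Re (A$1$1 + A$2$2) *\<^sub>R gl_basis 0 + (Re (A$1$2 + A$2$1) *\<^sub>R gl_basis 1
    + (Im (A$1$2 - A$2$1) *\<^sub>R gl_basis 2 + (Re (A$1$1 - A$2$2) *\<^sub>R gl_basis 3
    + (Im (A$1$2 + A$2$1) *\<^sub>R gl_basis 4 + (Re (A$2$1 - A$1$2) *\<^sub>R gl_basis 5
    + Im (A$1$1 - A$2$2) *\<^sub>R gl_basis 6)))))"
    using A unfolding cmat2_eq_iff
    by (simp add: gl_basis_nth complex_eq_iff field_simps del: One_nat_def)
  from arg_cong[OF this, of \<phi>] show ?thesis
    by (simp only: add scale closed closed' basis add.assoc)
qed

text \<open>If a covector with components \<open>M * a i\<close> attains its minimum \<open>M > 0\<close> on the control set at a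
  unit vector \<open>u\<close>, then \<open>u = Herm_of a\<close>; the signs are those of the Lorentz product.\<close>

definition Herm_of :: "(nat \<Rightarrow> real) \<Rightarrow> cmat2" where
  "Herm_of a = a 0 *\<^sub>R gl_basis 0 - (a 1 *\<^sub>R gl_basis 1 + a 2 *\<^sub>R gl_basis 2 + a 3 *\<^sub>R gl_basis 3)"

text \<open>For the components of the covector of an extremal, divided by the minimum, this matrix is constant
  in time; it is, up to sign, the generator of the second one-parameter subgroup.\<close>

definition skew_of :: "(nat \<Rightarrow> real) \<Rightarrow> cmat2" where
  "skew_of a = a 4 *\<^sub>R gl_basis 4 + a 5 *\<^sub>R gl_basis 5 + a 6 *\<^sub>R gl_basis 6"

lemma Herm_of_nth:
  "Herm_of a $1$1 = of_real ((a 0 - a 3) / 2)" "Herm_of a $2$2 = of_real ((a 0 + a 3) / 2)"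
  "Herm_of a $1$2 = Complex (- a 1 / 2) (- a 2 / 2)" "Herm_of a $2$1 = Complex (- a 1 / 2) (a 2 / 2)"
  by (simp_all add: Herm_of_def gl_basis_nth complex_eq_iff field_simps del: One_nat_def)

lemma skew_of_nth:
  "skew_of a $1$1 = Complex 0 (a 6 / 2)" "skew_of a $2$2 = Complex 0 (- a 6 / 2)"
  "skew_of a $1$2 = Complex (- a 5 / 2) (a 4 / 2)" "skew_of a $2$1 = Complex (a 5 / 2) (a 4 / 2)"
  by (simp_all add: skew_of_def gl_basis_nth complex_eq_iff field_simps del: One_nat_def)

lemma lie_bracket_nth: "lie_bracket A B $ i $ j = A$i$1 * B$1$j + A$i$2 * B$2$j - (B$i$1 * A$1$j + B$i$2 * A$2$j)"
  by (simp add: lie_bracket_def cmat2_mult_nth)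

lemma lie_bracket_skew_of_Herm_of:
  "lie_bracket (skew_of a) (Herm_of a) \<in> Herm"
  "Herm_coord 0 (lie_bracket (skew_of a) (Herm_of a)) = 0"
  by (simp_all add: Herm_eq Herm_coord_simps lie_bracket_nth Herm_of_nth skew_of_nth complex_eq_iff algebra_simps
      add_divide_distrib diff_divide_distrib)

text \<open>The right-hand side of the adjoint equation for a covector that is tied to its minimizer. The
  components on \<open>gl_basis 0\<close> and on the skew-Hermitian basis vectors are conserved; the others say
  that the minimizer moves by \<open>U' = [skew_of a, U]\<close>.\<close>

lemma dual_lie_bracket_Herm_of:
  assumes \<phi>: "\<phi> \<in> gl_plus_dual" and a: "\<And>i. \<phi> (gl_basis i) = M * a i"
  shows "\<phi> (lie_bracket (Herm_of a) (gl_basis 0)) = 0"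
    "\<phi> (lie_bracket (Herm_of a) (gl_basis 1)) = - M * Herm_coord 1 (lie_bracket (skew_of a) (Herm_of a))"
    "\<phi> (lie_bracket (Herm_of a) (gl_basis 2)) = - M * Herm_coord 2 (lie_bracket (skew_of a) (Herm_of a))"
    "\<phi> (lie_bracket (Herm_of a) (gl_basis 3)) = - M * Herm_coord 3 (lie_bracket (skew_of a) (Herm_of a))"
    "\<phi> (lie_bracket (Herm_of a) (gl_basis 4)) = 0"
    "\<phi> (lie_bracket (Herm_of a) (gl_basis 5)) = 0"
    "\<phi> (lie_bracket (Herm_of a) (gl_basis 6)) = 0"
  unfolding gl_plus_dual_expand[OF \<phi> lie_bracket_in_gl_plus] a
  by (simp_all add: lie_bracket_nth gl_basis_nth Herm_of_nth skew_of_nth Herm_coord_simps field_simps del: One_nat_def)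


section \<open>Normal extremals are products of exponentials\<close>

lemma continuous_on_UNIV_if_intervals:
  fixes f :: "real \<Rightarrow> 'a::topological_space"
  assumes "\<And>a b. continuous_on {a..b} f"
  shows "continuous_on UNIV f"
proof -
  have "isCont f t" for t
    using continuous_on_interior[OF assms[of "t - 1" "t + 1"], of t] by simp
  then show ?thesis by (simp add: continuous_at_imp_continuous_on)
qed

lemma AE_const_lebesgue:
  assumes "AE t in (lebesgue :: real measure). P"
  shows P
proof (rule ccontr)
  assume "\<not> P"
  obtain N where N: "negligible N" "{t :: real. \<not> P} \<subseteq> N"
    using assms unfolding eventually_ae_filter_negligible by auto
  then have "N = UNIV" using \<open>\<not> P\<close> by auto
  with N have "negligible (UNIV :: real set)" by simp
  then show False using open_not_negligible[of "UNIV :: real set"] by simp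
qed

text \<open>In the frame rotated by \<open>exp (t B)\<close> the control is the constant \<open>H\<close>, so the curve
  \<open>g t exp (t B)\<close> has the constant left-invariant velocity \<open>H + B\<close>.\<close>

lemma conj_exp_control_curve_eq_exp_product:
  fixes g :: "real \<Rightarrow> cmat2"
  assumes g: "\<And>t. (g has_vector_derivative g t ** (matrix_exp (t *\<^sub>R B) ** H ** matrix_exp ((- t) *\<^sub>R B))) (at t)"
  shows "g t = g 0 ** matrix_exp (t *\<^sub>R (H + B)) ** matrix_exp ((- t) *\<^sub>R B)"
proof -
  let ?E = "\<lambda>t. matrix_exp (t *\<^sub>R B)" and ?E' = "\<lambda>t. matrix_exp ((- t) *\<^sub>R B)"
  let ?F = "\<lambda>t. matrix_exp (t *\<^sub>R (H + B))" and ?F' = "\<lambda>t. matrix_exp ((- t) *\<^sub>R (H + B))"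
  have "((\<lambda>t. g t ** ?E t ** ?F' t) has_vector_derivative 0) (at t)" for t
  proof -
    have "((\<lambda>t. g t ** ?E t ** ?F' t) has_vector_derivative
        (g t ** ?E t) ** (- ((H + B) ** ?F' t)) +
        (g t ** (B ** ?E t) + (g t ** (?E t ** H ** ?E' t)) ** ?E t) ** ?F' t) (at t)"
      by (intro cmat2_mult.has_vector_derivative has_vector_derivative_matrix_exp
          has_vector_derivative_matrix_exp_minus g)
    moreover have "(g t ** (?E t ** H ** ?E' t)) ** ?E t = g t ** ?E t ** H"
      by (metis matrix_mul_assoc matrix_exp_minus_left matrix_mul_rid)
    moreover have "(g t ** ?E t) ** (- ((H + B) ** ?F' t)) + (g t ** (B ** ?E t) + g t ** ?E t ** H) ** ?F' t = 0"
      unfolding matrix_exp_commute[of B t]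
      by (simp add: cmat2_mult.minus_right cmat2_mult.diff_right cmat2_mult.add_right cmat2_mult.add_left
          matrix_mul_assoc del: scaleR_minus_left)
    ultimately show ?thesis by (simp only:)
  qed
  then have "g t ** ?E t ** ?F' t = g 0"
    using has_vector_derivative_zero_eq[of "\<lambda>t. g t ** ?E t ** ?F' t" t] by simp
  then have "g 0 ** ?F t ** ?E' t = g t ** ?E t ** (?F' t ** ?F t) ** ?E' t"
    by (metis matrix_mul_assoc)
  also have "\<dots> = g t"
    unfolding matrix_exp_minus_left by (metis matrix_mul_assoc matrix_mul_rid matrix_exp_minus_right)
  finally show ?thesis by simp
qed

text \<open>The constants are the components of the covector at time 0, divided by the minimum \<open>M\<close>. Since
  \<open>M > 0\<close>, the minimum condition recovers the control from the covector, so that outside a null set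
  it agrees with a continuous curve, for which all equations hold at every time.\<close>

lemma normal_extremal_imp_exp_product:
  assumes ext: "extremal_lift g u \<psi> M" and M: "M > 0" and g0: "g 0 = mat 1"
  obtains a where "a 0 = sqrt (1 + (a 1)\<^sup>2 + (a 2)\<^sup>2 + (a 3)\<^sup>2)"
    "\<And>t. g t = matrix_exp (t *\<^sub>R (Herm_of a + skew_of a)) ** matrix_exp ((- t) *\<^sub>R skew_of a)"
proof -
  have hor: "\<And>a b. \<exists>L. L-lipschitz_on {a..b} g"
      "AE t in lebesgue. u t \<in> Herm \<and> (g has_vector_derivative g t ** u t) (at t)"
    and fut: "AE t in lebesgue. pseudo_inner (u t) (gl_basis 0) > 0"
    and arc: "AE t in lebesgue. pseudo_inner (u t) (u t) = 1"
    and dual: "\<And>t. \<psi> t \<in> gl_plus_dual"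
    and ac: "\<And>w a b. w \<in> gl_plus \<Longrightarrow> absolutely_continuous_on {a..b} (\<lambda>t. \<psi> t w)"
    and ode: "AE t in lebesgue. \<forall>w\<in>gl_plus.
        ((\<lambda>s. \<psi> s w) has_real_derivative \<psi> t (lie_bracket (u t) w)) (at t)"
    and opt: "AE t in lebesgue. is_arg_min (\<psi> t) (\<lambda>v. v \<in> control_set) (u t) \<and> \<psi> t (u t) = M"
    using ext unfolding extremal_lift_def horizontal_curve_def future_directed_def arclength_parametrized_def
    by blast+
  define q where "q t i = \<psi> t (gl_basis i) / M" for t i
  have q: "\<psi> t (gl_basis i) = M * q t i" for t i
    using M by (simp add: q_def)
  define U where "U t = Herm_of (q t)" for t
  define B where "B t = skew_of (q t)" for t
  have cq: "continuous_on UNIV (\<lambda>t. q t i)" if "i \<le> 6" for i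
  proof -
    have "continuous_on UNIV (\<lambda>t. \<psi> t (gl_basis i))"
      using ac[OF gl_basis_in_gl_plus[OF that]]
      by (intro continuous_on_UNIV_if_intervals vector_absolutely_continuous_on_imp_continuous_on)
        (simp add: vector_absolutely_continuous_on_real)
    then show ?thesis unfolding q_def using M by (intro continuous_intros) auto
  qed
  \<comment> \<open>Continuity is what allows passing from almost every time to every time.\<close>
  have cU: "continuous_on UNIV U" and cB: "continuous_on UNIV B"
    unfolding U_def B_def Herm_of_def skew_of_def by (intro continuous_intros cq; simp)+
  have uU: "AE t in lebesgue. u t = U t"
    using hor(2) fut arc opt
  proof eventually_elim
    case (elim t)
    have "M * q t i = M * pseudo_inner (u t) (gl_basis i)" if "i \<le> 3" for i
    proof -
      have "\<psi> t (gl_basis i) = \<psi> t (u t) * pseudo_inner (u t) (gl_basis i)"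
        using elim dual gl_basis_in_Herm[OF that]
        by (intro minimizer_imp_multiple_of_pseudo_inner) (auto simp: is_arg_min_linorder)
      then show ?thesis using elim by (simp add: q)
    qed
    then have qi: "q t i = pseudo_inner (u t) (gl_basis i)" if "i \<le> 3" for i
      using that M by simp
    have "q t 0 = Herm_coord 0 (u t)" "q t 1 = - Herm_coord 1 (u t)"
      "q t 2 = - Herm_coord 2 (u t)" "q t 3 = - Herm_coord 3 (u t)"
      by (simp_all add: qi pseudo_inner_coords Herm_coord_gl_basis del: One_nat_def)
    then have "U t = Herm_coord 0 (u t) *\<^sub>R gl_basis 0 + Herm_coord 1 (u t) *\<^sub>R gl_basis 1
        + Herm_coord 2 (u t) *\<^sub>R gl_basis 2 + Herm_coord 3 (u t) *\<^sub>R gl_basis 3"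
      by (simp add: U_def Herm_of_def del: One_nat_def)
    with Herm_expand[of "u t"] elim show "u t = U t" by metis
  qed
  have g': "(g has_vector_derivative g t ** U t) (at t)" for t
  proof (rule vector_absolutely_continuous_on_AE_derivative_continuous)
    show acg: "vector_absolutely_continuous_on {a..b} g" for a b
      using hor(1) vector_absolutely_continuous_on_lipschitz by blast
    show "AE t in lebesgue. (g has_vector_derivative g t ** U t) (at t)"
      using hor(2) uU by eventually_elim simp
    have "continuous_on UNIV g"
      using acg by (intro continuous_on_UNIV_if_intervals vector_absolutely_continuous_on_imp_continuous_on)
    then show "continuous_on UNIV (\<lambda>t. g t ** U t)"
      using cU by (rule cmat2_mult.continuous_on)
  qed
  define D where "D t i = (if i = 1 \<or> i = 2 \<or> i = 3 then - Herm_coord i (lie_bracket (B t) (U t)) else 0)"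
    for t and i :: nat
  have \<psi>': "((\<lambda>t. \<psi> t (gl_basis i)) has_vector_derivative M * D t i) (at t)" if i: "i \<le> 6" for i t
  proof (rule vector_absolutely_continuous_on_AE_derivative_continuous)
    show "AE t in lebesgue. ((\<lambda>t. \<psi> t (gl_basis i)) has_vector_derivative M * D t i) (at t)"
      using ode uU
    proof eventually_elim
      case (elim t)
      then have "((\<lambda>s. \<psi> s (gl_basis i)) has_real_derivative \<psi> t (lie_bracket (U t) (gl_basis i))) (at t)"
        using gl_basis_in_gl_plus[OF i] by simp
      moreover have "\<psi> t (lie_bracket (U t) (gl_basis i)) = M * D t i"
      proof -
        have "i = 0 \<or> i = 1 \<or> i = 2 \<or> i = 3 \<or> i = 4 \<or> i = 5 \<or> i = 6" using i by linarith
        then show ?thesis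
          using dual_lie_bracket_Herm_of[OF dual q, of t]
          by (elim disjE) (simp_all add: U_def B_def D_def del: One_nat_def)
      qed
      ultimately show ?case by (simp add: has_real_derivative_iff_has_vector_derivative)
    qed
    show "continuous_on UNIV (\<lambda>t. M * D t i)"
    proof (cases "i = 1 \<or> i = 2 \<or> i = 3")
      case True
      have "continuous_on UNIV (\<lambda>t. lie_bracket (B t) (U t))"
        unfolding lie_bracket_def
        by (intro continuous_on_diff cmat2_mult.continuous_on cU cB)
      then have "continuous_on UNIV (\<lambda>t. Herm_coord i (lie_bracket (B t) (U t)))"
        unfolding Herm_coord_def trace_def
        by (intro continuous_intros cmat2_mult.continuous_on)
      then have "continuous_on UNIV (\<lambda>t. M * - Herm_coord i (lie_bracket (B t) (U t)))"
        by (intro continuous_intros)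
      then show ?thesis using True by (simp only: D_def if_True)
    next
      case False
      then show ?thesis by (simp only: D_def if_False continuous_on_const)
    qed
    show "vector_absolutely_continuous_on {a..b} (\<lambda>t. \<psi> t (gl_basis i))" for a b
      unfolding vector_absolutely_continuous_on_real by (rule ac[OF gl_basis_in_gl_plus[OF i]])
  qed
  have q': "((\<lambda>t. q t i) has_vector_derivative D t i) (at t)" if i: "i \<le> 6" for i t
    using has_vector_derivative_divide[OF \<psi>'[OF i, of t], of M] M by (simp add: q_def)
  have const: "q t i = q 0 i" if "i = 0 \<or> i = 4 \<or> i = 5 \<or> i = 6" for t i
  proof -
    have "((\<lambda>t. q t i) has_vector_derivative 0) (at t)" for t
      using q'[of i t] that by (auto simp: D_def)
    then show ?thesis using has_vector_derivative_zero_eq by blast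
  qed
  \<comment> \<open>The skew part of the covector is constant, so the equation for \<open>U\<close> is linear with a
    constant coefficient.\<close>
  have B0: "B t = B 0" for t
    using const[of 4 t] const[of 5 t] const[of 6 t] by (simp add: B_def skew_of_def)
  have "(U has_vector_derivative lie_bracket (B 0) (U t)) (at t)" for t
  proof -
    let ?L = "lie_bracket (B t) (U t)"
    have "(U has_vector_derivative D t 0 *\<^sub>R gl_basis 0
        - (D t 1 *\<^sub>R gl_basis 1 + D t 2 *\<^sub>R gl_basis 2 + D t 3 *\<^sub>R gl_basis 3)) (at t)"
      unfolding U_def Herm_of_def
      by (intro has_vector_derivative_diff has_vector_derivative_add
          bounded_linear.has_vector_derivative[OF bounded_linear_scaleR_left] q') auto
    moreover have "D t 0 *\<^sub>R gl_basis 0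
        - (D t 1 *\<^sub>R gl_basis 1 + D t 2 *\<^sub>R gl_basis 2 + D t 3 *\<^sub>R gl_basis 3) = ?L"
    proof -
      have "?L = Herm_coord 1 ?L *\<^sub>R gl_basis 1 + Herm_coord 2 ?L *\<^sub>R gl_basis 2 + Herm_coord 3 ?L *\<^sub>R gl_basis 3"
        using Herm_expand[OF lie_bracket_skew_of_Herm_of(1)[of "q t"]] lie_bracket_skew_of_Herm_of(2)[of "q t"]
        by (simp add: U_def B_def del: One_nat_def)
      moreover have "D t 0 *\<^sub>R gl_basis 0
          - (D t 1 *\<^sub>R gl_basis 1 + D t 2 *\<^sub>R gl_basis 2 + D t 3 *\<^sub>R gl_basis 3)
          = Herm_coord 1 ?L *\<^sub>R gl_basis 1 + Herm_coord 2 ?L *\<^sub>R gl_basis 2 + Herm_coord 3 ?L *\<^sub>R gl_basis 3"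
        by (simp add: D_def algebra_simps del: One_nat_def)
      ultimately show ?thesis by (rule trans[rotated, OF sym])
    qed
    ultimately show ?thesis by (simp only: B0[of t])
  qed
  then have U: "U t = matrix_exp (t *\<^sub>R B 0) ** U 0 ** matrix_exp ((- t) *\<^sub>R B 0)" for t
    by (rule lie_bracket_ode_unique)
  have "g t = matrix_exp (t *\<^sub>R (Herm_of (q 0) + skew_of (q 0))) ** matrix_exp ((- t) *\<^sub>R skew_of (q 0))" for t
  proof -
    have "(g has_vector_derivative
        g s ** (matrix_exp (s *\<^sub>R B 0) ** U 0 ** matrix_exp ((- s) *\<^sub>R B 0))) (at s)" for s
      using g'[of s] unfolding U[of s] .
    from conj_exp_control_curve_eq_exp_product[OF this] show ?thesis
      by (simp add: U_def B_def g0)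
  qed
  moreover have "q 0 0 = sqrt (1 + (q 0 1)\<^sup>2 + (q 0 2)\<^sup>2 + (q 0 3)\<^sup>2)"
  proof -
    have inner: "pseudo_inner (U t) (U t) = (q t 0)\<^sup>2 - ((q t 1)\<^sup>2 + (q t 2)\<^sup>2 + (q t 3)\<^sup>2)" for t
      by (simp add: U_def pseudo_inner_coords Herm_coord_simps Herm_of_nth power2_eq_square
          field_simps del: One_nat_def)
    have "AE t in lebesgue. (q t 0)\<^sup>2 - ((q t 1)\<^sup>2 + (q t 2)\<^sup>2 + (q t 3)\<^sup>2) = 1"
      using arc uU by eventually_elim (simp only: inner)
    then have "(\<lambda>t. (q t 0)\<^sup>2 - ((q t 1)\<^sup>2 + (q t 2)\<^sup>2 + (q t 3)\<^sup>2)) = (\<lambda>t. 1)"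
      by (rule AE_continuous_imp_eq) (intro continuous_intros cq; simp)+
    then have sq: "(q 0 0)\<^sup>2 = 1 + (q 0 1)\<^sup>2 + (q 0 2)\<^sup>2 + (q 0 3)\<^sup>2"
      by (auto simp: fun_eq_iff dest: spec[of _ 0])
    have "AE t in (lebesgue :: real measure). q 0 0 > 0"
      using fut uU
    proof eventually_elim
      case (elim t)
      have "pseudo_inner (U t) (gl_basis 0) = q t 0"
        by (simp add: pseudo_inner_e0 U_def Herm_coord_simps Herm_of_nth field_simps)
      then show ?case using elim const[of 0 t] by simp
    qed
    then have "q 0 0 > 0" by (rule AE_const_lebesgue)
    then show ?thesis
      by (metis sq real_sqrt_unique less_imp_le)
  qed
  ultimately show ?thesis using that by blast
qed


section \<open>Products of exponentials are normal extremals\<close>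

definition adjoint_cmat2 :: "cmat2 \<Rightarrow> cmat2" where
  "adjoint_cmat2 X = (\<chi> i j. cnj (X$j$i))"

lemma bounded_linear_adjoint_cmat2: "bounded_linear adjoint_cmat2"
  unfolding linear_conv_bounded_linear[symmetric]
  by (rule linearI) (simp_all add: adjoint_cmat2_def vec_eq_iff)

lemma Herm_iff_adjoint: "X \<in> Herm \<longleftrightarrow> adjoint_cmat2 X = X"
  by (auto simp: Herm_eq adjoint_cmat2_def cmat2_eq_iff complex_eq_iff)

lemma adjoint_lie_bracket_skew_of:
  "adjoint_cmat2 (lie_bracket (skew_of a) X) = lie_bracket (skew_of a) (adjoint_cmat2 X)"
  by (simp add: adjoint_cmat2_def cmat2_eq_iff lie_bracket_nth skew_of_nth complex_eq_iff algebra_simps)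

lemma Herm_of_in_Herm: "Herm_of a \<in> Herm"
  by (simp add: Herm_eq Herm_of_nth complex_eq_iff)

text \<open>The conjugate and its adjoint solve the same linear equation with the same initial value.\<close>

lemma conj_exp_skew_of_in_Herm:
  assumes "X \<in> Herm"
  shows "matrix_exp (t *\<^sub>R skew_of a) ** X ** matrix_exp ((- t) *\<^sub>R skew_of a) \<in> Herm"
proof -
  let ?Y = "\<lambda>t. matrix_exp (t *\<^sub>R skew_of a) ** X ** matrix_exp ((- t) *\<^sub>R skew_of a)"
  have "((\<lambda>t. adjoint_cmat2 (?Y t)) has_vector_derivative
      lie_bracket (skew_of a) (adjoint_cmat2 (?Y t))) (at t)" for t
    unfolding adjoint_lie_bracket_skew_of[symmetric]
    by (rule bounded_linear.has_vector_derivative[OF bounded_linear_adjoint_cmat2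
        has_vector_derivative_conj_matrix_exp])
  from lie_bracket_ode_unique[OF this, of t] have "adjoint_cmat2 (?Y t) = ?Y t"
    using assms by (simp add: Herm_iff_adjoint)
  then show ?thesis by (simp add: Herm_iff_adjoint)
qed

lemma trace_conj_matrix_exp:
  "trace (matrix_exp (t *\<^sub>R B) ** X ** matrix_exp ((- t) *\<^sub>R B)) = trace X"
  by (subst trace_mul_sym) (simp only: matrix_mul_assoc matrix_exp_minus_left matrix_mul_lid)

lemma det_conj_matrix_exp:
  "det (matrix_exp (t *\<^sub>R B) ** X ** matrix_exp ((- t) *\<^sub>R B)) = det X"
proof -
  have "det (matrix_exp (t *\<^sub>R B)) * det (matrix_exp ((- t) *\<^sub>R B)) = 1"
    by (simp only: det_mul[symmetric] matrix_exp_minus_right det_I)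
  then show ?thesis by (simp add: det_mul mult_ac)
qed

lemma det_derivative_left_invariant:
  assumes "(g has_vector_derivative g t ** U) (at t)"
  shows "((\<lambda>t. det (g t :: cmat2)) has_vector_derivative trace U * det (g t)) (at t)"
proof -
  have e: "((\<lambda>t. g t $ i $ j) has_vector_derivative (g t ** U) $ i $ j) (at t)" for i j
    by (rule bounded_linear.has_vector_derivative[OF bounded_linear_cmat2_nth assms])
  have "((\<lambda>t. g t $1$1 * g t $2$2 - g t $1$2 * g t $2$1) has_vector_derivative
     (g t $1$1 * (g t ** U)$2$2 + (g t ** U)$1$1 * g t $2$2)
     - (g t $1$2 * (g t ** U)$2$1 + (g t ** U)$1$2 * g t $2$1)) (at t)"
    by (intro has_vector_derivative_diff has_vector_derivative_mult e)
  moreover have "(g t $1$1 * (g t ** U)$2$2 + (g t ** U)$1$1 * g t $2$2)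
     - (g t $1$2 * (g t ** U)$2$1 + (g t ** U)$1$2 * g t $2$1) = trace U * det (g t)"
    by (simp add: det_2 trace_def sum_2 cmat2_mult_nth algebra_simps)
  ultimately show ?thesis by (simp add: det_2)
qed

text \<open>Liouville's formula for a control of constant trace.\<close>

lemma det_left_invariant_curve:
  fixes g :: "real \<Rightarrow> cmat2"
  assumes g: "\<And>t. (g has_vector_derivative g t ** U t) (at t)" and tr: "\<And>t. trace (U t) = of_real c"
  shows "det (g t) = det (g 0) * of_real (exp (c * t))"
proof -
  have "((\<lambda>t. det (g t) * of_real (exp (- c * t))) has_vector_derivative 0) (at t)" for t
  proof -
    have "((\<lambda>t. exp (- c * t)) has_real_derivative - c * exp (- c * t)) (at t)"
      by (auto intro!: derivative_eq_intros)
    then have "((\<lambda>t. det (g t) * of_real (exp (- c * t))) has_vector_derivative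
      det (g t) * of_real (- c * exp (- c * t)) + (trace (U t) * det (g t)) * of_real (exp (- c * t))) (at t)"
      by (intro has_vector_derivative_mult has_vector_derivative_of_real det_derivative_left_invariant g)
    then show ?thesis by (simp add: tr algebra_simps)
  qed
  then have "det (g t) * of_real (exp (- c * t)) = det (g 0)"
    using has_vector_derivative_zero_eq[of "\<lambda>t. det (g t) * of_real (exp (- c * t))" t] by simp
  moreover have "complex_of_real (exp (- c * t)) * of_real (exp (c * t)) = 1"
    unfolding of_real_mult[symmetric] by (simp flip: exp_add)
  ultimately show ?thesis by (metis mult.assoc mult.right_neutral)
qed

text \<open>The reverse Cauchy-Schwarz inequality for future directed timelike vectors. It reduces to the
  Cauchy-Schwarz inequality for the vectors \<open>(1, x1, x2, x3)\<close> and \<open>(1, y1, y2, y3)\<close>, which follows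
  from Lagrange's identity.\<close>

lemma pseudo_inner_ge_1:
  assumes "pseudo_inner u u \<ge> 1" "Herm_coord 0 u > 0" "pseudo_inner v v \<ge> 1" "Herm_coord 0 v > 0"
  shows "pseudo_inner u v \<ge> 1"
proof -
  have cs: "1 + (x1 * y1 + x2 * y2 + x3 * y3) \<le> x0 * y0"
    if x: "x0\<^sup>2 \<ge> 1 + x1\<^sup>2 + x2\<^sup>2 + x3\<^sup>2" "x0 > 0" and y: "y0\<^sup>2 \<ge> 1 + y1\<^sup>2 + y2\<^sup>2 + y3\<^sup>2" "y0 > 0"
    for x0 x1 x2 x3 y0 y1 y2 y3 :: real
  proof (rule power2_le_imp_le)
    have "(1 + (x1 * y1 + x2 * y2 + x3 * y3))\<^sup>2 \<le> (1 + x1\<^sup>2 + x2\<^sup>2 + x3\<^sup>2) * (1 + y1\<^sup>2 + y2\<^sup>2 + y3\<^sup>2)"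
    proof -
      have "(1 + x1\<^sup>2 + x2\<^sup>2 + x3\<^sup>2) * (1 + y1\<^sup>2 + y2\<^sup>2 + y3\<^sup>2) - (1 + (x1 * y1 + x2 * y2 + x3 * y3))\<^sup>2
        = (x1 - y1)\<^sup>2 + (x2 - y2)\<^sup>2 + (x3 - y3)\<^sup>2
          + (x1 * y2 - x2 * y1)\<^sup>2 + (x1 * y3 - x3 * y1)\<^sup>2 + (x2 * y3 - x3 * y2)\<^sup>2"
        by (simp add: power2_eq_square algebra_simps)
      moreover have "\<dots> \<ge> 0" by simp
      ultimately show ?thesis by linarith
    qed
    also have "\<dots> \<le> x0\<^sup>2 * y0\<^sup>2"
      using x y by (intro mult_mono) auto
    finally show "(1 + (x1 * y1 + x2 * y2 + x3 * y3))\<^sup>2 \<le> (x0 * y0)\<^sup>2"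
      by (simp add: power_mult_distrib)
  qed (use x y in simp)
  show ?thesis
    using cs[of "Herm_coord 1 u" "Herm_coord 2 u" "Herm_coord 3 u" "Herm_coord 0 u"
        "Herm_coord 1 v" "Herm_coord 2 v" "Herm_coord 3 v" "Herm_coord 0 v"] assms
    by (simp add: pseudo_inner_coords power2_eq_square del: One_nat_def)
qed

text \<open>Applied with \<open>P = u + B\<close>, where \<open>u\<close> is Hermitian with \<open>Herm_coord 0 u = c\<close> and \<open>B\<close> is
  skew-Hermitian, this is the Lorentz product with \<open>u\<close> on Hermitian matrices, while on the
  skew-Hermitian ones of trace zero it is \<open>- 2\<close> times the real trace form with \<open>B\<close>. The first summand corrects the
  sign of the \<open>gl_basis 0\<close> component.\<close>

definition extremal_covector :: "real \<Rightarrow> cmat2 \<Rightarrow> cmat2 \<Rightarrow> real" where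
  "extremal_covector c P w = 2 * c * Re (trace w) - 2 * Re (trace (P ** w))"

lemma extremal_covector_dual: "extremal_covector c P \<in> gl_plus_dual"
  by (simp add: gl_plus_dual_def extremal_covector_def trace_add cmat2_mult.add_right
      cmat2_mult.scaleR_right trace_def sum_2 algebra_simps)

lemma extremal_covector_Herm:
  assumes "u \<in> Herm" "v \<in> Herm"
  shows "extremal_covector (Herm_coord 0 u) (u + skew_of a) v = pseudo_inner u v"
  using assms unfolding Herm_eq
  by (simp add: extremal_covector_def pseudo_inner_coords Herm_coord_simps trace_def sum_2
      cmat2_mult_nth skew_of_nth algebra_simps del: One_nat_def)

lemma extremal_covector_lie_bracket:
  "extremal_covector c (u + B) (lie_bracket u w) = - 2 * Re (trace (lie_bracket B u ** w))"
  by (simp add: extremal_covector_def trace_def sum_2 cmat2_mult_nth lie_bracket_nth algebra_simps)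

lemma extremal_covector_derivative:
  assumes "(u has_vector_derivative u') (at t)"
  shows "((\<lambda>t. extremal_covector c (u t + B) w) has_vector_derivative - 2 * Re (trace (u' ** w))) (at t)"
proof -
  have "linear (\<lambda>X. - 2 * Re (trace (X ** w)))"
    by (rule linearI) (simp_all add: trace_def sum_2 cmat2_mult_nth algebra_simps)
  then have "bounded_linear (\<lambda>X. - 2 * Re (trace (X ** w)))"
    by (simp add: linear_conv_bounded_linear)
  then have "((\<lambda>t. - 2 * Re (trace (u t ** w))) has_vector_derivative - 2 * Re (trace (u' ** w))) (at t)"
    using assms by (rule bounded_linear.has_vector_derivative)
  then have "((\<lambda>t. (2 * c * Re (trace w) - 2 * Re (trace (B ** w))) + - 2 * Re (trace (u t ** w)))
      has_vector_derivative 0 + - 2 * Re (trace (u' ** w))) (at t)"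
    by (intro has_vector_derivative_add has_vector_derivative_const)
  then show ?thesis
    by (simp add: extremal_covector_def cmat2_mult.add_left trace_add algebra_simps)
qed

text \<open>The lift has minimum 1: on Hermitian matrices the covector is the Lorentz product with the
  control, which is at least 1 on the control set and equal to 1 at the control.\<close>

lemma exp_product_imp_extremal_lift:
  assumes a: "a 0 = sqrt (1 + (a 1)\<^sup>2 + (a 2)\<^sup>2 + (a 3)\<^sup>2)"
    and g: "\<And>t. g t = matrix_exp (t *\<^sub>R (Herm_of a + skew_of a)) ** matrix_exp ((- t) *\<^sub>R skew_of a)"
  shows "\<exists>u \<psi>. extremal_lift g u \<psi> 1"
proof -
  define B where "B = skew_of a"
  define H where "H = Herm_of a"
  define u where "u t = matrix_exp (t *\<^sub>R B) ** H ** matrix_exp ((- t) *\<^sub>R B)" for t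
  define \<psi> where "\<psi> t = extremal_covector (a 0) (u t + B)" for t
  have a0: "a 0 > 0" "(a 0)\<^sup>2 = 1 + (a 1)\<^sup>2 + (a 2)\<^sup>2 + (a 3)\<^sup>2"
    unfolding a by (auto intro!: add_pos_nonneg)
  have u': "(u has_vector_derivative lie_bracket B (u t)) (at t)" for t
    unfolding u_def by (rule has_vector_derivative_conj_matrix_exp)
  have g': "(g has_vector_derivative g t ** u t) (at t)" for t
  proof -
    let ?F = "\<lambda>t. matrix_exp (t *\<^sub>R (H + B))" and ?E = "\<lambda>t. matrix_exp (t *\<^sub>R B)"
    let ?E' = "\<lambda>t. matrix_exp ((- t) *\<^sub>R B)"
    have "((\<lambda>t. ?F t ** ?E' t) has_vector_derivative
        ?F t ** (- (B ** ?E' t)) + ((H + B) ** ?F t) ** ?E' t) (at t)"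
      by (intro cmat2_mult.has_vector_derivative has_vector_derivative_matrix_exp
          has_vector_derivative_matrix_exp_minus)
    moreover have "?F t ** (- (B ** ?E' t)) + ((H + B) ** ?F t) ** ?E' t = ?F t ** H ** ?E' t"
      unfolding matrix_exp_commute[of "H + B" t]
      by (simp add: cmat2_mult.minus_right cmat2_mult.add_right cmat2_mult.add_left
          matrix_mul_assoc del: scaleR_minus_left)
    moreover have "?F t ** H ** ?E' t = (?F t ** ?E' t) ** u t"
    proof -
      have "(?F t ** ?E' t) ** u t = ?F t ** (?E' t ** ?E t) ** H ** ?E' t"
        by (simp only: u_def matrix_mul_assoc)
      then show ?thesis by (simp only: matrix_exp_minus_left matrix_mul_rid)
    qed
    moreover have "g = (\<lambda>t. ?F t ** ?E' t)"
      unfolding H_def B_def by (rule ext) (rule g)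
    ultimately show ?thesis by (simp only:)
  qed
  have contu: "continuous_on S u" and contg: "continuous_on S g" for S
    using u' g' by (auto intro!: continuous_at_imp_continuous_on has_vector_derivative_continuous)
  have Herm: "u t \<in> Herm" for t
    unfolding u_def B_def H_def by (rule conj_exp_skew_of_in_Herm[OF Herm_of_in_Herm])
  have trace: "trace (u t) = of_real (a 0)" for t
    unfolding u_def trace_conj_matrix_exp
    by (simp add: H_def trace_def sum_2 Herm_of_nth complex_eq_iff field_simps)
  have coord0: "Herm_coord 0 (u t) = a 0" for t
    using arg_cong[OF trace[of t], of Re] by (simp add: Herm_coord_simps trace_def sum_2)
  have unit: "pseudo_inner (u t) (u t) = 1" for t
  proof -
    have "complex_of_real (pseudo_inner (u t) (u t)) = 4 * det H"
      unfolding pseudo_inner_self[OF Herm] unfolding u_def det_conj_matrix_exp ..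
    also have "\<dots> = complex_of_real (pseudo_inner H H)"
      by (simp add: pseudo_inner_self H_def Herm_of_in_Herm)
    also have "pseudo_inner H H = (a 0)\<^sup>2 - ((a 1)\<^sup>2 + (a 2)\<^sup>2 + (a 3)\<^sup>2)"
      by (simp add: H_def pseudo_inner_coords Herm_coord_simps Herm_of_nth power2_eq_square
          field_simps del: One_nat_def)
    finally show ?thesis using a0(2) by simp
  qed
  have control: "u t \<in> control_set" for t
    using Herm unit coord0 a0(1) by (simp add: control_set_def pseudo_inner_e0)
  have "g 0 = mat 1" by (simp add: g)
  then have "det (g t) = of_real (exp (a 0 * t))" for t
    using det_left_invariant_curve[OF g' trace, of t] by simp
  then have "range g \<subseteq> GL_plus"
    by (auto simp: GL_plus_def)
  moreover have "\<exists>L. L-lipschitz_on {s..t} g" for s t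
    by (rule lipschitz_on_C1[OF has_vector_derivative_at_within[OF g']])
      (intro cmat2_mult.continuous_on contg contu)
  ultimately have "horizontal_curve g u"
    unfolding horizontal_curve_def using Herm g' by simp
  moreover have "u \<in> borel_measurable lebesgue"
    using contu[of UNIV] by (simp add: borel_measurable_continuous_onI measurable_completion)
  moreover have val: "\<psi> t v = pseudo_inner (u t) v" if "v \<in> Herm" for t v
    using extremal_covector_Herm[OF Herm that, of t a] by (simp add: \<psi>_def B_def coord0)
  moreover have "\<exists>w\<in>gl_plus. \<psi> t w \<noteq> 0" for t
    using val[OF Herm, of t t] unit Herm Herm_subset_gl_plus
    by (intro bexI[of _ "u t"]) auto
  moreover have \<psi>': "((\<lambda>s. \<psi> s w) has_vector_derivative \<psi> t (lie_bracket (u t) w)) (at t)" for t w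
    unfolding \<psi>_def extremal_covector_lie_bracket
    by (rule extremal_covector_derivative[OF u'])
  moreover have "absolutely_continuous_on {s..t} (\<lambda>r. \<psi> r w)" for s t w
  proof -
    have "continuous_on {s..t} (\<lambda>r. \<psi> r (lie_bracket (u r) w))"
      unfolding \<psi>_def extremal_covector_lie_bracket unfolding lie_bracket_def trace_def
      by (intro continuous_intros cmat2_mult.continuous_on contu)
    then have "\<exists>L. L-lipschitz_on {s..t} (\<lambda>r. \<psi> r w)"
      by (rule lipschitz_on_C1[OF has_vector_derivative_at_within[OF \<psi>']])
    then show ?thesis
      using vector_absolutely_continuous_on_lipschitz
      unfolding vector_absolutely_continuous_on_real[symmetric] by blast
  qed
  moreover have "is_arg_min (\<psi> t) (\<lambda>v. v \<in> control_set) (u t) \<and> \<psi> t (u t) = 1" for t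
  proof -
    have "\<psi> t v \<ge> 1" if "v \<in> control_set" for v
      using that control[of t] val[of v t]
      by (auto simp: control_set_def pseudo_inner_e0 intro: pseudo_inner_ge_1)
    then show ?thesis
      using control[of t] val[OF Herm, of t t] unit by (simp add: is_arg_min_linorder)
  qed
  ultimately have "extremal_lift g u \<psi> 1"
    using unit control a0(1) coord0
    by (auto simp: extremal_lift_def future_directed_def arclength_parametrized_def pseudo_inner_e0
        has_real_derivative_iff_has_vector_derivative \<psi>_def extremal_covector_dual)
  then show ?thesis by blast
qed

theorem theorem6:
  fixes g :: "real \<Rightarrow> cmat2"
  shows "timelike_extremal g \<and> normal_extremal g \<and> g 0 = mat 1 \<longleftrightarrow>
    (\<exists>\<alpha> :: nat \<Rightarrow> real.
       \<alpha> 0 = sqrt (1 + (\<alpha> 1)\<^sup>2 + (\<alpha> 2)\<^sup>2 + (\<alpha> 3)\<^sup>2) \<and>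
       (\<forall>t. g t = matrix_exp (t *\<^sub>R (\<Sum>i=0..6. \<alpha> i *\<^sub>R gl_basis i)) **
                  matrix_exp ((- t) *\<^sub>R (\<Sum>i=4..6. \<alpha> i *\<^sub>R gl_basis i))))"
    (is "?ext \<longleftrightarrow> ?prod")
proof -
  \<comment> \<open>The constants in the exponents are coordinates of the control and those in \<open>Herm_of\<close> are
    covector components; they differ by the sign of the spatial part.\<close>
  define \<sigma> where "\<sigma> \<alpha> i = (if i \<in> {1, 2, 3} then - \<alpha> i else \<alpha> i)" for \<alpha> :: "nat \<Rightarrow> real" and i :: nat
  have \<sigma>_simps: "\<sigma> \<alpha> 0 = \<alpha> 0" "\<sigma> \<alpha> 1 = - \<alpha> 1" "\<sigma> \<alpha> 2 = - \<alpha> 2" "\<sigma> \<alpha> 3 = - \<alpha> 3"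
    "\<sigma> \<alpha> 4 = \<alpha> 4" "\<sigma> \<alpha> 5 = \<alpha> 5" "\<sigma> \<alpha> 6 = \<alpha> 6" for \<alpha>
    by (simp_all add: \<sigma>_def)
  have \<sigma>\<sigma>: "\<sigma> (\<sigma> \<alpha>) = \<alpha>" for \<alpha> by (auto simp: \<sigma>_def)
  have skew: "(\<Sum>i=4..6. \<alpha> i *\<^sub>R gl_basis i) = skew_of (\<sigma> \<alpha>)" for \<alpha>
  proof -
    have "{4..6} = {4, 5, 6 :: nat}" by auto
    then show ?thesis by (simp add: skew_of_def \<sigma>_simps)
  qed
  have full: "(\<Sum>i=0..6. \<alpha> i *\<^sub>R gl_basis i) = Herm_of (\<sigma> \<alpha>) + skew_of (\<sigma> \<alpha>)" for \<alpha>
    unfolding sum_0_6 by (simp add: Herm_of_def skew_of_def \<sigma>_simps del: One_nat_def)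
  show ?thesis
  proof
    assume ?ext
    then obtain u \<psi> M where lift: "extremal_lift g u \<psi> M" "M > 0" "g 0 = mat 1"
      by (auto simp: normal_extremal_def)
    obtain a where a: "a 0 = sqrt (1 + (a 1)\<^sup>2 + (a 2)\<^sup>2 + (a 3)\<^sup>2)"
      "\<And>t. g t = matrix_exp (t *\<^sub>R (Herm_of a + skew_of a)) ** matrix_exp ((- t) *\<^sub>R skew_of a)"
      using normal_extremal_imp_exp_product[OF lift] by metis
    show ?prod
      unfolding skew full using a
      by (intro exI[of _ "\<sigma> a"]) (simp only: \<sigma>\<sigma> \<sigma>_simps power2_minus simp_thms)
  next
    assume ?prod
    then obtain \<alpha> where \<alpha>: "\<alpha> 0 = sqrt (1 + (\<alpha> 1)\<^sup>2 + (\<alpha> 2)\<^sup>2 + (\<alpha> 3)\<^sup>2)"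
      "\<And>t. g t = matrix_exp (t *\<^sub>R (Herm_of (\<sigma> \<alpha>) + skew_of (\<sigma> \<alpha>))) ** matrix_exp ((- t) *\<^sub>R skew_of (\<sigma> \<alpha>))"
      unfolding skew full by blast
    then obtain u \<psi> where "extremal_lift g u \<psi> 1"
      using exp_product_imp_extremal_lift[of "\<sigma> \<alpha>" g] by (auto simp: \<sigma>_simps simp del: One_nat_def)
    moreover have "g 0 = mat 1" by (simp add: \<alpha>(2))
    ultimately show ?ext
      unfolding timelike_extremal_def normal_extremal_def by (meson zero_less_one)
  qed
qed

end
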